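(* Let $f_{32}$, $\check f_{32}$, $f_{35}$, $y_{\beta_1}$, $y_{\beta_2}$, $y_x$ be the functions defined in the context. Then: (i) $f_{32}(x)$ is a constant multiple of $y_{\beta_2}(x)$, and $\check f_{32}(x)$ is a constant multiple of $y_{\beta_1}(x)$ (the constants do not depend on $x$); (ii) $f_{35}(x)$ is a pseudo-constant multiple of $y_x(x)$, i.e. $f_{35}(x)=S(x)\,y_x(x)$ for a function $S$ with $S(qx)=S(x)$.
   Context: $q$ is a complex number with $0<|q|<1$. Notation: $(a;q)_n=\prod_{j=0}^{n-1}(1-q^ja)$, $(a;q)_\infty=\prod_{j=0}^\infty(1-q^ja)$, $(a_1,\dots,a_N;q)_n=\prod_i(a_i;q)_n$ (also for $n=\infty$), and $${}_3\phi_2\left(\begin{array}{c}a_1,a_2,a_3\\ b_1,b_2\end{array};q,z\right)=\sum_{n=0}^\infty\frac{(a_1,a_2,a_3;q)_n}{(q;q)_n(b_1,b_2;q)_n}z^n.$$ $\alpha_1,\alpha_2,\beta_1,\beta_2\in\mathbb{C}\setminus\{0\}$, $\lambda,\mu'\in\mathbb{C}$ with $q^{\mu'}\alpha_1\alpha_2/(\beta_1\beta_2)=1$ and $|q^\lambda\alpha_1\alpha_2/(\beta_1\beta_2)|<1$. Parameters are generic, so that no denominator vanishes. Values of $\log q,\log\beta_1,\log\beta_2,\log x$ are fixed with $\log(qx)=\log q+\log x$, and $t^s=\exp(s\log t)$. A pseudo-constant is a function $S(x)$ with $S(qx)=S(x)$. Integral solutions: $$y_{\beta_1}(x)=(1-q)\beta_1^{\lambda-\mu'}x^\lambda\frac{(\beta_1x,q,q\beta_1/\beta_2;q)_\infty}{(q^{-\lambda}\beta_1x,\beta_1/\alpha_1,q\beta_1/\alpha_2;q)_\infty}\,{}_3\phi_2\left(\begin{array}{c}q^{-\lambda}\beta_1x,\beta_1/\alpha_1,q\beta_1/\alpha_2\\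 \beta_1x,q\beta_1/\beta_2\end{array};q,q^\lambda\frac{\alpha_1\alpha_2}{\beta_1\beta_2}\right),$$ $$y_{\beta_2}(x)=(1-q)\beta_2^{\lambda-\mu'}x^\lambda\frac{(\beta_2x,q,q\beta_2/\beta_1;q)_\infty}{(q^{-\lambda}\beta_2x,\beta_2/\alpha_1,q\beta_2/\alpha_2;q)_\infty}\,{}_3\phi_2\left(\begin{array}{c}q^{-\lambda}\beta_2x,\beta_2/\alpha_1,q\beta_2/\alpha_2\\ \beta_2x,q\beta_2/\beta_1\end{array};q,q^\lambda\frac{\alpha_1\alpha_2}{\beta_1\beta_2}\right),$$ $$y_x(x)=(1-q)q^{\lambda-\mu'}x^{\mu'}\frac{(q^2/(\beta_1x),q^2/(\beta_2x),q;q)_\infty}{(q/(\alpha_1x),q^2/(\alpha_2x),q^{-\lambda+1};q)_\infty}\,{}_3\phi_2\left(\begin{array}{c}q^{-\lambda+1},q/(\alpha_1x),q^2/(\alpha_2x)\\ q^2/(\beta_1x),q^2/(\beta_2x)\end{array};q,q^\lambda\frac{\alpha_1\alpha_2}{\beta_1\beta_2}\right).$$ Series of Fujii–Nobukawa type: $$f_{32}(x)=x^\lambda\,{}_3\phi_2\left(\begin{array}{c}q^\lambda\alpha_1\alpha_2/(\beta_1\beta_2),q^\lambda,q^{\lambda+1}/(\beta_1x)\\ q^{\lambda+1}\alpha_1/\beta_1,q^\lambda\alpha_2/\beta_1\end{array};q,q^{-\lambda}\beta_2x\right)\quad(|q^{-\lambda}\beta_2x|<1),$$ $\check f_{32}(x)$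 is obtained from $f_{32}(x)$ by interchanging $\beta_1$ and $\beta_2$ (considered for $|q^{-\lambda}\beta_1x|<1$), and $$f_{35}(x)=x^\lambda\frac{(\alpha_2x/q;q)_\infty}{(q^{-\lambda-1}\beta_1\beta_2x/\alpha_1;q)_\infty}\,{}_3\phi_2\left(\begin{array}{c}q^\lambda\alpha_1\alpha_2/(\beta_1\beta_2),q\alpha_1/\beta_1,q\alpha_1/\beta_2\\ q^{\lambda+2}\alpha_1/(\beta_1\beta_2x),q\alpha_1\alpha_2/(\beta_1\beta_2)\end{array};q,\frac q{\alpha_1x}\right)\quad(|q/(\alpha_1x)|<1).$$ The identities are asserted where the series converge. *)

theory Defs
  imports "HOL-Analysis.Analysis"
begin

definition qpoch :: "complex \<Rightarrow> complex \<Rightarrow> nat \<Rightarrow> complex" where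
  "qpoch q a n = (\<Prod>j<n. 1 - q ^ j * a)"

definition qpoch_inf :: "complex \<Rightarrow> complex \<Rightarrow> complex" where
  "qpoch_inf q a = (\<Prod>j. 1 - q ^ j * a)"

definition qpochs :: "complex \<Rightarrow> complex list \<Rightarrow> nat \<Rightarrow> complex" where
  "qpochs q as n = (\<Prod>a\<leftarrow>as. qpoch q a n)"

definition qpochs_inf :: "complex \<Rightarrow> complex list \<Rightarrow> complex" where
  "qpochs_inf q as = (\<Prod>a\<leftarrow>as. qpoch_inf q a)"

definition phi32 ::
  "complex \<Rightarrow> complex \<Rightarrow> complex \<Rightarrow> complex \<Rightarrow> complex \<Rightarrow> complex \<Rightarrow> complex \<Rightarrow> complex"
  where
  "phi32 a1 a2 a3 b1 b2 q z =
     (\<Sum>n. qpochs q [a1, a2, a3] n / (qpoch q q n * qpochs q [b1, b2] n) * z ^ n)"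

text \<open>
  No factor of \<open>(b;q)\<^sub>n\<close> or of \<open>(b;q)\<^sub>\<infinity>\<close> is zero, so that these symbols may
  stand in a denominator.
\<close>
definition qnonzero :: "complex \<Rightarrow> complex \<Rightarrow> bool" where
  "qnonzero q b \<longleftrightarrow> (\<forall>j::nat. 1 - q ^ j * b \<noteq> 0)"

text \<open>
  The power \<open>t\<^sup>s\<close> formed with the chosen value \<open>l\<close> of \<open>log t\<close>. Below, \<open>lq\<close>
  and \<open>lb1\<close> are the chosen values of \<open>log q\<close> and \<open>log b1\<close>, and
  \<open>L x\<close> is the chosen value of \<open>log x\<close>.
\<close>
definition pow_log :: "complex \<Rightarrow> complex \<Rightarrow> complex" where
  "pow_log l s = exp (s * l)"

text \<open>
  As written, \<open>y_beta\<close> is \<open>y\<^bsub>b1\<^esub>\<close>; the solution \<open>y\<^bsub>b2\<^esub>\<close> is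
  \<open>y_beta q lq a1 a2 b2 b1 lb2 lam mu L\<close>: its formula is the one below with
  \<open>b1\<close> and \<open>b2\<close> (and the corresponding logarithms) interchanged.
\<close>
definition y_beta ::
  "complex \<Rightarrow> complex \<Rightarrow> complex \<Rightarrow> complex \<Rightarrow> complex \<Rightarrow> complex \<Rightarrow> complex
    \<Rightarrow> complex \<Rightarrow> complex \<Rightarrow> (complex \<Rightarrow> complex) \<Rightarrow> complex \<Rightarrow> complex"
  where
  "y_beta q lq a1 a2 b1 b2 lb1 lam mu L x =
     (1 - q) * pow_log lb1 (lam - mu) * pow_log (L x) lam
     * (qpochs_inf q [b1 * x, q, q * b1 / b2]
        / qpochs_inf q [pow_log lq (- lam) * b1 * x, b1 / a1, q * b1 / a2])
     * phi32 (pow_log lq (- lam) * b1 * x) (b1 / a1) (q * b1 / a2)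
             (b1 * x) (q * b1 / b2)
             q (pow_log lq lam * (a1 * a2 / (b1 * b2)))"

definition y_x ::
  "complex \<Rightarrow> complex \<Rightarrow> complex \<Rightarrow> complex \<Rightarrow> complex \<Rightarrow> complex
    \<Rightarrow> complex \<Rightarrow> complex \<Rightarrow> (complex \<Rightarrow> complex) \<Rightarrow> complex \<Rightarrow> complex"
  where
  "y_x q lq a1 a2 b1 b2 lam mu L x =
     (1 - q) * pow_log lq (lam - mu) * pow_log (L x) mu
     * (qpochs_inf q [q\<^sup>2 / (b1 * x), q\<^sup>2 / (b2 * x), q]
        / qpochs_inf q [q / (a1 * x), q\<^sup>2 / (a2 * x), pow_log lq (- lam + 1)])
     * phi32 (pow_log lq (- lam + 1)) (q / (a1 * x)) (q\<^sup>2 / (a2 * x))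
             (q\<^sup>2 / (b1 * x)) (q\<^sup>2 / (b2 * x))
             q (pow_log lq lam * (a1 * a2 / (b1 * b2)))"

definition f32 ::
  "complex \<Rightarrow> complex \<Rightarrow> complex \<Rightarrow> complex \<Rightarrow> complex \<Rightarrow> complex
    \<Rightarrow> complex \<Rightarrow> (complex \<Rightarrow> complex) \<Rightarrow> complex \<Rightarrow> complex"
  where
  "f32 q lq a1 a2 b1 b2 lam L x =
     pow_log (L x) lam
     * phi32 (pow_log lq lam * (a1 * a2 / (b1 * b2))) (pow_log lq lam)
             (pow_log lq (lam + 1) / (b1 * x))
             (pow_log lq (lam + 1) * a1 / b1) (pow_log lq lam * a2 / b1)
             q (pow_log lq (- lam) * b2 * x)"

definition f32_check ::
  "complex \<Rightarrow> complex \<Rightarrow> complex \<Rightarrow> complex \<Rightarrow> complex \<Rightarrow> complex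
    \<Rightarrow> complex \<Rightarrow> (complex \<Rightarrow> complex) \<Rightarrow> complex \<Rightarrow> complex"
  where
  "f32_check q lq a1 a2 b1 b2 lam L x = f32 q lq a1 a2 b2 b1 lam L x"

definition f35 ::
  "complex \<Rightarrow> complex \<Rightarrow> complex \<Rightarrow> complex \<Rightarrow> complex \<Rightarrow> complex
    \<Rightarrow> complex \<Rightarrow> (complex \<Rightarrow> complex) \<Rightarrow> complex \<Rightarrow> complex"
  where
  "f35 q lq a1 a2 b1 b2 lam L x =
     pow_log (L x) lam
     * (qpoch_inf q (a2 * x / q) / qpoch_inf q (pow_log lq (- lam - 1) * b1 * b2 * x / a1))
     * phi32 (pow_log lq lam * (a1 * a2 / (b1 * b2))) (q * a1 / b1) (q * a1 / b2)
             (pow_log lq (lam + 2) * a1 / (b1 * b2 * x)) (q * a1 * a2 / (b1 * b2))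
             q (q / (a1 * x))"

end

theory Submission
  imports Defs
begin

text \<open>
  All three identities are instances of one transformation of a series \<open>\<^sub>3\<phi>\<^sub>2\<close>, with
  numerator parameters \<open>a, b, c\<close>, denominator parameters \<open>d, e\<close> and argument \<open>z = de/(abc)\<close>,
  into one with argument \<open>b\<close> (lemma \<open>phi32_transformation\<close>):
  \[ {}_3\phi_2(a,b,c;d,e;q,z) =
     \frac{(b,zc,za;q)_\infty}{(d,e,z;q)_\infty}\, {}_3\phi_2(z,d/b,e/b;zc,za;q,b). \]
  For \<open>y\<^bsub>b2\<^esub>\<close> the choice \<open>b = q\<^bsup>-lam\<^esup> b2 x\<close> makes the right-hand series that of \<open>f32\<close>, and the
  factors of the prefactor that depend on \<open>x\<close> cancel against those in \<open>y\<^bsub>b2\<^esub>\<close>. For \<open>y\<^sub>x\<close> the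
  choice \<open>b = q/(a1 x)\<close> gives the series of \<open>f35\<close>. Here the remaining dependence on \<open>x\<close> is
  \<open>x\<^bsup>lam-mu\<^esup>\<close> times a quotient of two values of \<open>\<theta>(t) = (t, q/t; q)\<^sub>\<infinity>\<close>. Since
  \<open>\<theta>(qt) = - \<theta>(t)/t\<close>, the quotient is multiplied by a constant when \<open>x\<close> is replaced by \<open>qx\<close>, and the
  equation \<open>q\<^bsup>mu\<^esup> a1 a2/(b1 b2) = 1\<close> says that the power of \<open>x\<close> compensates this constant.

  The transformation is usually obtained by applying a Heine-type transformation repeatedly, which
  requires analytic continuation because intermediate series converge only for some parameters.
  To avoid that, the infinite products are kept inside the summands (\<open>three_phi_two_entire\<close>), and both
  sides are expanded in the values of \<open>(sa, sc; q)\<^sub>\<infinity> / (s; q)\<^sub>\<infinity>\<close> at \<open>s = z q\<^sup>j\<close>. Three expansions are stacked: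
  \<open>two_phi_one_zero\<close> for \<open>\<Sum>\<^sub>n (a, c; q)\<^sub>n s\<^sup>n / (q; q)\<^sub>n\<close>, then \<open>two_phi_one_with_numerator\<close> with one extra
  infinite product in the summand, then the full series. The first compares coefficients of powers
  of \<open>c\<close>. Each of the other two expands an infinite product, or a quotient of two, by the
  \<open>q\<close>-binomial theorem, exchanges the two summations, applies the previous step to the inner sum, and
  collects along diagonals, where the finite \<open>q\<close>-binomial theorem evaluates the coefficient.
  Every double series involved is dominated by a product of two convergent series for all
  parameters with \<open>|z| < 1\<close> and \<open>|b| < 1\<close>.
\<close>

section \<open>Double series\<close>

text \<open>
  Domination by a product of two summable sequences is the only convergence criterion used for
  double series; it permits both the exchange of summations and the summation along diagonals.
\<close>
lemma dominated_double_series: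
  fixes f :: "nat \<Rightarrow> nat \<Rightarrow> complex"
  assumes \<alpha>: "summable \<alpha>" and \<beta>: "summable \<beta>"
    and nonneg: "\<And>i. 0 \<le> \<alpha> i" "\<And>k. 0 \<le> \<beta> k"
    and bound: "\<And>i k. norm (f i k) \<le> M * (\<alpha> i * \<beta> k)"
  shows double_series_swap: "(\<Sum>i. \<Sum>k. f i k) = (\<Sum>k. \<Sum>i. f i k)"
    and double_series_rows_summable: "summable (\<lambda>i. \<Sum>k. f i k)"
    and double_series_columns_summable: "summable (\<lambda>k. \<Sum>i. f i k)"
    and double_series_diagonals_summable: "summable (\<lambda>j. \<Sum>i\<le>j. f i (j - i))"
    and double_series_diagonal: "(\<Sum>i. \<Sum>k. f i k) = (\<Sum>j. \<Sum>i\<le>j. f i (j - i))"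
proof -
  let ?g = "\<lambda>(i, k). f i k"
  have on: "\<alpha> summable_on UNIV" "\<beta> summable_on UNIV"
    using \<alpha> \<beta> nonneg by (simp_all add: summable_on_UNIV_nonneg_real_iff)
  have "(\<lambda>(i, k). \<alpha> i * \<beta> k) summable_on UNIV \<times> UNIV"
  proof (rule summable_on_SigmaI)
    show "((\<lambda>k. (case (i, k) of (i, k) \<Rightarrow> \<alpha> i * \<beta> k)) has_sum \<alpha> i * infsum \<beta> UNIV) UNIV" for i
      using has_sum_cmult_right[OF has_sum_infsum[OF on(2)], of "\<alpha> i"] by simp
    show "(\<lambda>i. \<alpha> i * infsum \<beta> UNIV) summable_on UNIV"
      by (rule summable_on_cmult_left[OF on(1)])
  qed (simp add: nonneg)
  then have "(\<lambda>(i, k). M * (\<alpha> i * \<beta> k)) summable_on UNIV \<times> UNIV"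
    using summable_on_cmult_right[of "\<lambda>(i, k). \<alpha> i * \<beta> k" _ M] by (simp add: case_prod_unfold)
  then have "(\<lambda>p. norm (?g p)) summable_on UNIV \<times> UNIV"
    by (rule Infinite_Sum.abs_summable_on_comparison_test') (simp add: bound case_prod_unfold)
  then have g: "?g summable_on UNIV \<times> UNIV"
    by (rule abs_summable_summable)
  have row: "summable (\<lambda>k. norm (f i k))" for i
    by (rule summable_comparison_test'[OF summable_mult[OF \<beta>, of "M * \<alpha> i"], where N = 0])
       (use bound[of i] in \<open>simp add: mult.assoc\<close>)
  have column: "summable (\<lambda>i. norm (f i k))" for k
    by (rule summable_comparison_test'[OF summable_mult[OF \<alpha>, of "M * \<beta> k"], where N = 0])
       (use bound[of _ k] in \<open>simp add: ac_simps\<close>)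
  have rows: "(\<Sum>\<^sub>\<infinity>k. f i k) = (\<Sum>k. f i k)" for i
    by (rule infsumI[OF norm_summable_imp_has_sum[OF row summable_sums]])
       (rule summable_norm_cancel[OF row])
  have columns: "(\<Sum>\<^sub>\<infinity>i. f i k) = (\<Sum>i. f i k)" for k
    by (rule infsumI[OF norm_summable_imp_has_sum[OF column summable_sums]])
       (rule summable_norm_cancel[OF column])
  have outer: "infsum h UNIV = suminf h" if "h summable_on UNIV" for h :: "nat \<Rightarrow> complex"
    using has_sum_imp_sums[OF has_sum_infsum[OF that]] by (simp add: sums_iff)
  have rows_on: "(\<lambda>i. \<Sum>\<^sub>\<infinity>k. f i k) summable_on UNIV"
    using summable_on_Sigma_banach[of f UNIV "\<lambda>_. UNIV"] g by simp
  then show "summable (\<lambda>i. \<Sum>k. f i k)"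
    by (simp add: rows summable_on_imp_summable)
  from rows_on have iterated: "(\<Sum>\<^sub>\<infinity>i. \<Sum>\<^sub>\<infinity>k. f i k) = (\<Sum>i. \<Sum>k. f i k)"
    using outer by (simp add: rows)
  have "(\<lambda>(k, i). f i k) summable_on UNIV \<times> UNIV"
    using g by (subst summable_on_swap) auto
  then have columns_on: "(\<lambda>k. \<Sum>\<^sub>\<infinity>i. f i k) summable_on UNIV"
    using summable_on_Sigma_banach[of "\<lambda>k i. f i k" UNIV "\<lambda>_. UNIV"] by simp
  then show "summable (\<lambda>k. \<Sum>i. f i k)"
    by (simp add: columns summable_on_imp_summable)
  from columns_on have "(\<Sum>\<^sub>\<infinity>k. \<Sum>\<^sub>\<infinity>i. f i k) = (\<Sum>k. \<Sum>i. f i k)"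
    using outer by (simp add: columns)
  then show "(\<Sum>i. \<Sum>k. f i k) = (\<Sum>k. \<Sum>i. f i k)"
    using infsum_swap_banach[OF g] iterated by simp
  have bij: "bij_betw (\<lambda>(j, i). (i, j - i)) (SIGMA j:UNIV. {..j}) (UNIV \<times> UNIV :: (nat \<times> nat) set)"
    by (rule bij_betw_byWitness[where f' = "\<lambda>(i, k). (i + k, i)"]) auto
  have tri: "(\<lambda>(j, i). f i (j - i)) summable_on (SIGMA j:UNIV. {..j})"
    using summable_on_reindex_bij_betw[OF bij, of ?g] g by (simp add: case_prod_unfold)
  show "summable (\<lambda>j. \<Sum>i\<le>j. f i (j - i))"
    using summable_on_Sigma_banach[OF tri] by (simp add: summable_on_imp_summable)
  have "(\<Sum>\<^sub>\<infinity>i. \<Sum>\<^sub>\<infinity>k. f i k) = infsum ?g (UNIV \<times> UNIV)"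
    using infsum_Sigma'_banach[of f UNIV "\<lambda>_. UNIV"] g by simp
  also have "\<dots> = infsum (\<lambda>(j, i). f i (j - i)) (SIGMA j:UNIV. {..j})"
    using infsum_reindex_bij_betw[OF bij, of ?g] by (simp add: case_prod_unfold)
  also have "\<dots> = (\<Sum>\<^sub>\<infinity>j. \<Sum>i\<le>j. f i (j - i))"
    using infsum_Sigma'_banach[OF tri] by simp
  also have "\<dots> = (\<Sum>j. \<Sum>i\<le>j. f i (j - i))"
    using outer summable_on_Sigma_banach[OF tri] by simp
  finally show "(\<Sum>i. \<Sum>k. f i k) = (\<Sum>j. \<Sum>i\<le>j. f i (j - i))"
    using iterated by simp
qed

section \<open>Shifted factorials\<close>

locale q_base =
  fixes q :: complex
  assumes norm_q: "norm q < 1"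
begin

lemma qpoch_0 [simp]: "qpoch q a 0 = 1"
  by (simp add: qpoch_def)

lemma qpoch_Suc: "qpoch q a (Suc n) = qpoch q a n * (1 - a * q ^ n)"
  by (simp add: qpoch_def mult.commute)

lemma qpoch_add: "qpoch q a (m + n) = qpoch q a m * qpoch q (a * q ^ m) n"
  by (induction n) (simp_all add: qpoch_Suc power_add algebra_simps)

lemma qpoch_Suc': "qpoch q a (Suc n) = (1 - a) * qpoch q (a * q) n"
  using qpoch_add[of a 1 n] by (simp add: qpoch_Suc)

lemma qpoch_eq_0_iff: "qpoch q a n = 0 \<longleftrightarrow> (\<exists>j<n. 1 - q ^ j * a = 0)"
  by (auto simp: qpoch_def)

lemma qpoch_nonzero: "qnonzero q a \<Longrightarrow> qpoch q a n \<noteq> 0"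
  by (simp add: qpoch_eq_0_iff qnonzero_def)

lemma qnonzero_small: "norm a < 1 \<Longrightarrow> qnonzero q a"
proof -
  assume a: "norm a < 1"
  have "norm (q ^ j * a) < 1" for j
  proof -
    have "norm (q ^ j * a) \<le> 1 * norm a"
      unfolding norm_mult norm_power
      by (intro mult_right_mono power_le_one) (use norm_q in auto)
    with a show ?thesis by simp
  qed
  then show ?thesis
    unfolding qnonzero_def by (metis eq_iff_diff_eq_0 norm_one order_less_irrefl)
qed

lemma qnonzero_q: "qnonzero q q"
  by (rule qnonzero_small[OF norm_q])

lemma qpoch_q_nonzero: "qpoch q q n \<noteq> 0"
  by (rule qpoch_nonzero[OF qnonzero_q])

lemma norm_shift_less: "norm s < 1 \<Longrightarrow> norm (s * q ^ n) < 1"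
proof -
  assume s: "norm s < 1"
  have "norm (s * q ^ n) \<le> norm s * 1"
    unfolding norm_mult norm_power by (intro mult_left_mono power_le_one) (use norm_q in auto)
  with s show ?thesis by simp
qed

lemma convergent_qprod: "convergent_prod (\<lambda>j. 1 - q ^ j * a)"
proof -
  have "summable (\<lambda>j. norm a * norm q ^ j)"
    by (intro summable_mult summable_geometric) (use norm_q in auto)
  then have "abs_convergent_prod (\<lambda>j. 1 - q ^ j * a)"
    by (simp add: abs_convergent_prod_conv_summable norm_mult norm_power mult.commute)
  then show ?thesis by (rule abs_convergent_prod_imp_convergent_prod)
qed

lemma qpoch_tendsto: "(\<lambda>n. qpoch q a n) \<longlonglongrightarrow> qpoch_inf q a"
  using convergent_prod_LIMSEQ[OF convergent_qprod]
  unfolding qpoch_def qpoch_inf_def by (simp add: LIMSEQ_lessThan_iff_atMost)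

lemma qpoch_inf_nonzero: "qnonzero q a \<Longrightarrow> qpoch_inf q a \<noteq> 0"
  unfolding qpoch_inf_def qnonzero_def
  using prodinf_nonzero[OF convergent_qprod] by blast

lemma qpoch_inf_split: "qpoch_inf q a = qpoch q a n * qpoch_inf q (a * q ^ n)"
proof -
  have "(\<lambda>k. qpoch q a (k + n)) \<longlonglongrightarrow> qpoch_inf q a"
    by (rule LIMSEQ_ignore_initial_segment[OF qpoch_tendsto])
  moreover have "(\<lambda>k. qpoch q a (k + n)) \<longlonglongrightarrow> qpoch q a n * qpoch_inf q (a * q ^ n)"
    unfolding add.commute[of _ n] qpoch_add by (intro tendsto_mult tendsto_const qpoch_tendsto)
  ultimately show ?thesis by (rule LIMSEQ_unique)
qed

lemma qpoch_inf_shift: "qpoch_inf q a = (1 - a) * qpoch_inf q (a * q)"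
  using qpoch_inf_split[of a 1] by (simp add: qpoch_Suc)

lemma qpoch_Bseq: "Bseq (qpoch q a)"
  by (rule convergent_imp_Bseq[OF convergentI[OF qpoch_tendsto]])

lemma inverse_qpoch_Bseq: "qnonzero q a \<Longrightarrow> Bseq (\<lambda>n. 1 / qpoch q a n)"
  using convergent_imp_Bseq[OF convergentI[OF tendsto_inverse[OF qpoch_tendsto qpoch_inf_nonzero]]]
  by (simp add: inverse_eq_divide)

section \<open>The homogeneous $q$-binomial theorem\<close>

text \<open>
  Homogenizing \<open>(u; q)\<^sub>n\<close> to \<open>v\<^sup>n (u/v; q)\<^sub>n\<close> without division makes the value \<open>v = 0\<close> available.
  There it is \<open>(-u)\<^sup>n q\<^bsup>n(n-1)/2\<^esup>\<close>, the coefficient in Euler's expansion of \<open>(u; q)\<^sub>\<infinity>\<close>, so that one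
  theorem covers both this expansion and the usual \<open>q\<close>-binomial series (\<open>v = 1\<close>).
\<close>
definition qhom :: "complex \<Rightarrow> complex \<Rightarrow> nat \<Rightarrow> complex" where
  "qhom v u n = (\<Prod>i<n. v - u * q ^ i)"

lemma qhom_0 [simp]: "qhom v u 0 = 1"
  by (simp add: qhom_def)

lemma qhom_Suc: "qhom v u (Suc n) = qhom v u n * (v - u * q ^ n)"
  by (simp add: qhom_def)

lemma qhom_scale: "qhom (s * v) (s * u) n = s ^ n * qhom v u n"
  by (induction n) (simp_all add: qhom_Suc algebra_simps)

lemma qhom_one: "qhom 1 u n = qpoch q u n"
  by (induction n) (simp_all add: qhom_Suc qpoch_Suc)

lemma qhom_zero: "qhom 0 u n = u ^ n * qhom 0 1 n"
  using qhom_scale[of u 0 1 n] by simp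

lemma norm_qhom_zero_le: "norm x \<le> 1 \<Longrightarrow> norm (qhom 0 x n) \<le> 1"
  unfolding qhom_def
  by (induction n) (use norm_q in \<open>auto simp: norm_mult norm_power intro!: mult_le_one power_le_one\<close>)

lemma qhom_zero_add: "qhom 0 u (m + n) = qhom 0 u m * qhom 0 (u * q ^ m) n"
  by (induction n) (simp_all add: qhom_Suc power_add algebra_simps)

lemma summable_qhom:
  assumes "norm (v * t) < 1"
  shows "summable (\<lambda>k. norm (qhom v u k / qpoch q q k * t ^ k))"
proof -
  define r where "r k = norm ((v - u * q ^ k) * t / (1 - q * q ^ k))" for k
  have q0: "(\<lambda>k. q ^ k) \<longlonglongrightarrow> 0"
    by (rule LIMSEQ_power_zero) (use norm_q in auto)
  have "r \<longlonglongrightarrow> norm ((v - u * 0) * t / (1 - q * 0))"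
    unfolding r_def by (intro tendsto_intros q0) auto
  then have lim: "r \<longlonglongrightarrow> norm (v * t)" by simp
  obtain c where c: "norm (v * t) < c" "c < 1"
    using dense[OF assms] by blast
  have "eventually (\<lambda>k. r k < c) sequentially"
    using order_tendstoD(2)[OF lim c(1)] .
  then obtain N where N: "\<And>k. k \<ge> N \<Longrightarrow> r k < c"
    by (auto simp: eventually_sequentially)
  show ?thesis
  proof (rule summable_ratio_test[OF c(2)])
    fix k assume "k \<ge> N"
    have "norm (qhom v u (Suc k) / qpoch q q (Suc k) * t ^ Suc k)
        = r k * norm (qhom v u k / qpoch q q k * t ^ k)"
      unfolding r_def norm_mult[symmetric] by (simp add: qhom_Suc qpoch_Suc ac_simps)
    also have "\<dots> \<le> c * norm (qhom v u k / qpoch q q k * t ^ k)"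
      by (intro mult_right_mono less_imp_le[OF N[OF \<open>k \<ge> N\<close>]]) simp
    finally show "norm (norm (qhom v u (Suc k) / qpoch q q (Suc k) * t ^ Suc k))
        \<le> c * norm (norm (qhom v u k / qpoch q q k * t ^ k))" by simp
  qed
qed

text \<open>
  The recurrence for the coefficients is equivalent to \<open>(1 - vt) f(t) = (1 - ut) f(qt)\<close> for the sum
  \<open>f\<close>. Iterating, and using that \<open>f(q\<^sup>n t)\<close> tends to \<open>f(0) = 1\<close>, gives the product.
\<close>
lemma qhom_binomial:
  assumes t: "norm (v * t) < 1"
  shows "(\<lambda>k. qhom v u k / qpoch q q k * t ^ k) sums (qpoch_inf q (u * t) / qpoch_inf q (v * t))"
proof -
  define c where "c k = qhom v u k / qpoch q q k" for k
  define f where "f x = (\<Sum>k. c k * x ^ k)" for x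
  have summ: "summable (\<lambda>k. c k * x ^ k)" if "norm (v * x) < 1" for x
    using summable_norm_cancel[OF summable_qhom[OF that, of u]] by (simp add: c_def)
  have small: "norm (v * (x * q ^ n)) < 1" if "norm (v * x) < 1" for x n
    using norm_shift_less[OF that, of n] by (simp add: mult.assoc)
  have coeff: "c (Suc k) * (1 - q ^ Suc k) = c k * (v - u * q ^ k)" for k
    using qpoch_q_nonzero[of "Suc k"]
    by (auto simp: c_def qhom_Suc qpoch_Suc)
  have funeq: "(1 - v * x) * f x = (1 - u * x) * f (x * q)" if x: "norm (v * x) < 1" for x
  proof -
    have xq: "norm (v * (x * q)) < 1" using small[OF x, of 1] by simp
    have "f x - f (x * q) = (\<Sum>k. c k * x ^ k - c k * (x * q) ^ k)"
      unfolding f_def by (rule suminf_diff[OF summ[OF x] summ[OF xq]])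
    also have "\<dots> = (\<Sum>k. c (Suc k) * x ^ Suc k - c (Suc k) * (x * q) ^ Suc k)"
      using suminf_split_head[OF summable_diff[OF summ[OF x] summ[OF xq]]] by simp
    also have "\<dots> = (\<Sum>k. v * x * (c k * x ^ k) - u * x * (c k * (x * q) ^ k))"
    proof (rule suminf_cong)
      fix k
      have "c (Suc k) * x ^ Suc k - c (Suc k) * (x * q) ^ Suc k
          = (c (Suc k) * (1 - q ^ Suc k)) * x ^ Suc k"
        by (simp add: power_mult_distrib algebra_simps)
      then show "c (Suc k) * x ^ Suc k - c (Suc k) * (x * q) ^ Suc k
          = v * x * (c k * x ^ k) - u * x * (c k * (x * q) ^ k)"
        unfolding coeff by (simp add: power_mult_distrib algebra_simps)
    qed
    also have "\<dots> = v * x * f x - u * x * f (x * q)"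
      unfolding f_def
      by (subst suminf_diff[symmetric]) (simp_all add: summable_mult summ x xq suminf_mult)
    finally show ?thesis by (simp add: algebra_simps)
  qed
  have iter: "qpoch q (v * t) n * f t = qpoch q (u * t) n * f (t * q ^ n)" for n
  proof (induction n)
    case (Suc n)
    have "qpoch q (v * t) (Suc n) * f t = (1 - v * (t * q ^ n)) * (qpoch q (v * t) n * f t)"
      by (simp add: qpoch_Suc algebra_simps)
    also have "\<dots> = qpoch q (u * t) n * ((1 - v * (t * q ^ n)) * f (t * q ^ n))"
      by (simp add: Suc)
    also have "\<dots> = qpoch q (u * t) n * ((1 - u * (t * q ^ n)) * f (t * q ^ Suc n))"
      by (subst funeq[OF small[OF t]]) (simp add: algebra_simps)
    finally show ?case by (simp add: qpoch_Suc algebra_simps)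
  qed (simp)
  have "(\<lambda>n. f (t * q ^ n)) \<longlonglongrightarrow> f 0"
  proof (cases "t = 0")
    case False
    have "isCont f 0"
      unfolding f_def by (rule isCont_powser[OF summ[OF t]]) (use False in simp)
    moreover have "(\<lambda>n. t * q ^ n) \<longlonglongrightarrow> t * 0"
      by (intro tendsto_intros LIMSEQ_power_zero) (use norm_q in auto)
    ultimately show ?thesis by (auto intro: isCont_tendsto_compose)
  qed simp
  moreover have "f 0 = 1"
    using powser_zero[of c] by (simp add: f_def c_def)
  ultimately have "(\<lambda>n. qpoch q (u * t) n * f (t * q ^ n)) \<longlonglongrightarrow> qpoch_inf q (u * t) * 1"
    by (intro tendsto_mult qpoch_tendsto) simp
  moreover have "(\<lambda>n. qpoch q (u * t) n * f (t * q ^ n)) \<longlonglongrightarrow> qpoch_inf q (v * t) * f t"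
    unfolding iter[symmetric] by (intro tendsto_mult qpoch_tendsto tendsto_const)
  ultimately have "qpoch_inf q (v * t) * f t = qpoch_inf q (u * t)"
    using LIMSEQ_unique by fastforce
  then have "f t = qpoch_inf q (u * t) / qpoch_inf q (v * t)"
    using qpoch_inf_nonzero[OF qnonzero_small[OF t]] by (simp add: field_simps)
  then show ?thesis
    using summable_sums[OF summ[OF t]] by (simp add: f_def c_def)
qed

text \<open>
  The finite \<open>q\<close>-binomial theorem. The induction multiplies by \<open>1 - q\<^bsup>n+1\<^esup>\<close> and splits it as
  \<open>(1 - q\<^sup>k) + q\<^sup>k (1 - q\<^bsup>n+1-k\<^esup>)\<close>, so that each part cancels the last factor of one of the two
  denominators.
\<close>
lemma qhom_convolution:
  "qhom v u n / qpoch q q n = (\<Sum>k\<le>n. v ^ k / qpoch q q k * (qhom 0 u (n - k) / qpoch q q (n - k)))"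
proof (induction n)
  case (Suc n)
  let ?d = "\<lambda>k. qpoch q q k"
  let ?t = "\<lambda>n k. v ^ k / ?d k * (qhom 0 u (n - k) / ?d (n - k))"
  have d: "?d (Suc k) = ?d k * (1 - q ^ Suc k)" "?d k \<noteq> 0" "1 - q ^ Suc k \<noteq> 0" for k
    using qpoch_q_nonzero[of "Suc k"] by (auto simp: qpoch_Suc)
  have left: "(\<Sum>k\<le>Suc n. (1 - q ^ k) * ?t (Suc n) k) = v * (\<Sum>k\<le>n. ?t n k)"
  proof -
    have "(\<Sum>k\<le>Suc n. (1 - q ^ k) * ?t (Suc n) k)
        = (\<Sum>k\<le>n. (1 - q ^ Suc k) * ?t (Suc n) (Suc k))"
      by (subst sum.atMost_Suc_shift) simp
    also have "\<dots> = (\<Sum>k\<le>n. v * ?t n k)"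
      by (rule sum.cong) (use d(2,3) in \<open>auto simp: d(1) field_simps simp del: power_Suc\<close>, simp)
    finally show ?thesis by (simp add: sum_distrib_left)
  qed
  have right: "(\<Sum>k\<le>Suc n. q ^ k * (1 - q ^ (Suc n - k)) * ?t (Suc n) k)
      = - (u * q ^ n) * (\<Sum>k\<le>n. ?t n k)"
  proof -
    have "q ^ k * (1 - q ^ (Suc n - k)) * ?t (Suc n) k = - (u * q ^ n) * ?t n k" if "k \<le> n" for k
    proof -
      obtain m where n: "n = k + m" using \<open>k \<le> n\<close> le_Suc_ex by blast
      have "(1 - q ^ Suc m) * (qhom 0 u (Suc m) / ?d (Suc m)) = qhom 0 u m * (- (u * q ^ m)) / ?d m"
        using d(2,3)[of m] by (simp add: d(1) qhom_Suc del: power_Suc)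
      then have "q ^ k * (v ^ k / ?d k) * ((1 - q ^ Suc m) * (qhom 0 u (Suc m) / ?d (Suc m)))
          = q ^ k * (v ^ k / ?d k) * (qhom 0 u m * (- (u * q ^ m)) / ?d m)"
        by (simp only:)
      then show ?thesis
        by (simp add: n Suc_diff_le power_add mult_ac del: power_Suc)
    qed
    then show ?thesis by (simp add: sum_distrib_left)
  qed
  have "(1 - q ^ Suc n) * (\<Sum>k\<le>Suc n. ?t (Suc n) k)
      = (\<Sum>k\<le>Suc n. (1 - q ^ k) * ?t (Suc n) k + q ^ k * (1 - q ^ (Suc n - k)) * ?t (Suc n) k)"
    unfolding sum_distrib_left
  proof (rule sum.cong[OF refl])
    fix k assume "k \<in> {..Suc n}"
    then have "q ^ Suc n = q ^ k * q ^ (Suc n - k)"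
      by (simp only: power_add[symmetric]) simp
    then show "(1 - q ^ Suc n) * ?t (Suc n) k
        = (1 - q ^ k) * ?t (Suc n) k + q ^ k * (1 - q ^ (Suc n - k)) * ?t (Suc n) k"
      by (simp only: algebra_simps mult_1_left)
  qed
  also have "\<dots> = v * (qhom v u n / ?d n) + - (u * q ^ n) * (qhom v u n / ?d n)"
    by (simp only: sum.distrib left right Suc[symmetric])
  also have "\<dots> = (v - u * q ^ n) * (qhom v u n / ?d n)"
    by (simp only: distrib_right[symmetric] diff_conv_add_uminus)
  also have "\<dots> = (1 - q ^ Suc n) * (qhom v u (Suc n) / ?d (Suc n))"
    using d(2)[of n] d(3)[of n] by (simp add: d(1) qhom_Suc del: power_Suc)
  finally show ?case
    by (rule iffD1[OF mult_left_cancel[OF d(3)], symmetric])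
qed simp

lemma qpoch_inf_0 [simp]: "qpoch_inf q 0 = 1"
  by (simp add: qpoch_inf_def)

lemma Euler_expansion: "(\<lambda>k. qhom 0 u k / qpoch q q k * t ^ k) sums qpoch_inf q (u * t)"
  using qhom_binomial[of 0 t u] by simp

text \<open>
  Euler's expansion bounds \<open>(t q\<^sup>n; q)\<^sub>\<infinity>\<close> uniformly in \<open>n\<close>, even if \<open>(t; q)\<^sub>n\<close> vanishes and
  division by it is impossible.
\<close>
lemma qpoch_inf_Bseq: "Bseq (\<lambda>n. qpoch_inf q (t * q ^ n))"
proof (rule BseqI')
  fix n
  let ?e = "\<lambda>k. qhom 0 t k / qpoch q q k"
  have s1: "summable (\<lambda>k. norm (?e k * 1 ^ k))"
    by (rule summable_qhom) simp
  have le: "norm (?e k * (q ^ n) ^ k) \<le> norm (?e k * 1 ^ k)" for k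
  proof -
    have "norm (?e k) * norm ((q ^ n) ^ k) \<le> norm (?e k) * 1"
      unfolding norm_power by (intro mult_left_mono power_le_one) (use norm_q in auto)
    then show ?thesis by (simp add: norm_mult norm_divide)
  qed
  have s2: "summable (\<lambda>k. norm (?e k * (q ^ n) ^ k))"
    by (rule summable_qhom) simp
  have "norm (qpoch_inf q (t * q ^ n)) = norm (\<Sum>k. ?e k * (q ^ n) ^ k)"
    using Euler_expansion[of t "q ^ n"] by (simp add: sums_iff)
  also have "\<dots> \<le> (\<Sum>k. norm (?e k * 1 ^ k))"
    by (rule order_trans[OF summable_norm[OF s2] suminf_le[OF le s2 s1]])
  finally show "norm (qpoch_inf q (t * q ^ n)) \<le> (\<Sum>k. norm (?e k * 1 ^ k))" .
qed

lemma inverse_qpoch_inf_shift: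
  assumes "norm s < 1"
  shows "1 / qpoch_inf q (s * q ^ n) = qpoch q s n / qpoch_inf q s"
proof -
  have "qpoch_inf q s \<noteq> 0"
    by (rule qpoch_inf_nonzero[OF qnonzero_small[OF assms]])
  then show ?thesis
    using qpoch_inf_split[of s n] by (auto simp: field_simps)
qed

lemma qpoch_inf_ratio_Bseq:
  assumes "norm s < 1"
  shows "Bseq (\<lambda>n. qpoch_inf q (t * q ^ n) / qpoch_inf q (s * q ^ n))"
proof -
  have "Bseq (\<lambda>n. 1 / qpoch_inf q s * qpoch q s n * qpoch_inf q (t * q ^ n))"
    by (intro Bseq_mult Bfun_const qpoch_Bseq qpoch_inf_Bseq)
  then show ?thesis
    by (simp add: inverse_qpoch_inf_shift[OF assms, symmetric] divide_simps)
qed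

lemma summable_Bseq_geometric:
  assumes "Bseq B" "norm (s::complex) < 1"
  shows "summable (\<lambda>n. B n * s ^ n)"
proof -
  obtain K where K: "\<And>n. norm (B n) \<le> K" using assms(1) by (auto simp: Bseq_def)
  show ?thesis
  proof (rule summable_comparison_test'[where N = 0])
    show "summable (\<lambda>n. K * norm s ^ n)"
      by (intro summable_mult summable_geometric) (use assms in auto)
  qed (use K in \<open>auto simp: norm_mult norm_power intro!: mult_right_mono\<close>)
qed

section \<open>Transformations of basic hypergeometric series\<close>

text \<open>
  A terminating summation whose right-hand side contains the free parameter \<open>s\<close>; it matches the
  coefficients of \<open>c\<^sup>k\<close> on the two sides of \<open>two_phi_one_zero\<close>. In the induction,
  \<open>1 - q\<^bsup>k+1\<^esup> = (1 - q\<^bsup>k+1-i\<^esup>) + q\<^bsup>k+1-i\<^esup> (1 - q\<^sup>i)\<close> turns the sum into a combination of the sums of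
  length \<open>k\<close> for \<open>s\<close> and for \<open>sq\<close>. By the induction hypothesis for both values these are equal.
\<close>
lemma qpoch_expansion:
  "qpoch q a k / qpoch q q k =
     (\<Sum>i\<le>k. qhom 0 a i * qpoch q s i * qpoch q (s * a * q ^ i) (k - i)
            / (qpoch q q i * qpoch q q (k - i)))"
proof (induction k arbitrary: s)
  case (Suc k)
  let ?d = "\<lambda>k. qpoch q q k"
  define t where "t k s i = qhom 0 a i * qpoch q s i * qpoch q (s * a * q ^ i) (k - i) / (?d i * ?d (k - i))"
    for k s i
  have IH: "(\<Sum>i\<le>k. t k s i) = qpoch q a k / ?d k" for s
    unfolding t_def by (rule Suc[symmetric])
  have d: "?d (Suc n) = ?d n * (1 - q ^ Suc n)" "?d n \<noteq> 0" "1 - q ^ Suc n \<noteq> 0" for n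
    using qpoch_q_nonzero[of "Suc n"] by (auto simp: qpoch_Suc)
  have cancel: "x * (y * z / (u * (v * x))) = y * z / (u * v)" if "x \<noteq> 0" for x y z u v :: complex
    using that by simp
  have left: "(1 - q ^ (Suc k - i)) * t (Suc k) s i = (1 - s * a * q ^ k) * t k s i" if "i \<le> k" for i
  proof -
    obtain m where k: "k = i + m" using \<open>i \<le> k\<close> le_Suc_ex by blast
    have "(1 - q ^ (Suc k - i)) * t (Suc k) s i
        = qhom 0 a i * qpoch q s i * qpoch q (s * a * q ^ i) (Suc m) / (?d i * ?d m)"
      using d(2)[of m] d(3)[of m] by (simp add: k t_def Suc_diff_le d(1) del: power_Suc)
    also have "\<dots> = (1 - s * a * q ^ k) * t k s i"
      by (simp add: qpoch_Suc t_def k power_add mult_ac)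
    finally show ?thesis .
  qed
  have right: "q ^ (Suc k - Suc j) * (1 - q ^ Suc j) * t (Suc k) s (Suc j)
      = - a * q ^ k * (1 - s) * t k (s * q) j" if "j \<le> k" for j
  proof -
    have "(1 - q ^ Suc j) * t (Suc k) s (Suc j)
        = qhom 0 a (Suc j) * qpoch q s (Suc j) * qpoch q (s * a * q ^ Suc j) (k - j) / (?d j * ?d (k - j))"
      using d(2)[of j] d(3)[of j] by (simp add: t_def d(1) del: power_Suc)
    also have "\<dots> = - (a * q ^ j) * (1 - s) * t k (s * q) j"
      by (simp add: t_def qhom_Suc qpoch_Suc'[of s] mult_ac)
    finally have "q ^ (k - j) * ((1 - q ^ Suc j) * t (Suc k) s (Suc j))
        = q ^ (k - j) * (- (a * q ^ j) * (1 - s) * t k (s * q) j)"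
      by (simp only:)
    moreover have "q ^ k = q ^ (k - j) * q ^ j"
      using that by (simp add: power_add[symmetric])
    ultimately show ?thesis by (simp add: mult_ac)
  qed
  have "(1 - q ^ Suc k) * (\<Sum>i\<le>Suc k. t (Suc k) s i)
      = (\<Sum>i\<le>Suc k. (1 - q ^ (Suc k - i)) * t (Suc k) s i + q ^ (Suc k - i) * (1 - q ^ i) * t (Suc k) s i)"
    unfolding sum_distrib_left
  proof (rule sum.cong[OF refl])
    fix i assume "i \<in> {..Suc k}"
    then have "q ^ Suc k = q ^ (Suc k - i) * q ^ i"
      by (simp only: power_add[symmetric]) simp
    then show "(1 - q ^ Suc k) * t (Suc k) s i
        = (1 - q ^ (Suc k - i)) * t (Suc k) s i + q ^ (Suc k - i) * (1 - q ^ i) * t (Suc k) s i"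
      by (simp only: algebra_simps mult_1_left)
  qed
  also have "\<dots> = (\<Sum>i\<le>k. (1 - q ^ (Suc k - i)) * t (Suc k) s i)
      + (\<Sum>j\<le>k. q ^ (Suc k - Suc j) * (1 - q ^ Suc j) * t (Suc k) s (Suc j))"
    unfolding sum.distrib
    by (subst (2) sum.atMost_Suc_shift) simp
  also have "\<dots> = (1 - s * a * q ^ k) * (\<Sum>i\<le>k. t k s i) + - a * q ^ k * (1 - s) * (\<Sum>j\<le>k. t k (s * q) j)"
    unfolding sum_distrib_left by (intro arg_cong2[where f = plus] sum.cong refl left right) auto
  also have "\<dots> = ((1 - s * a * q ^ k) + - a * q ^ k * (1 - s)) * (qpoch q a k / ?d k)"
    unfolding IH by (simp only: distrib_right)
  also have "(1 - s * a * q ^ k) + - a * q ^ k * (1 - s) = 1 - a * q ^ k"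
    by (simp add: algebra_simps)
  also have "(1 - a * q ^ k) * (qpoch q a k / ?d k) = (1 - q ^ Suc k) * (qpoch q a (Suc k) / ?d (Suc k))"
    using d(3)[of k] by (simp add: d(1) qpoch_Suc[of a] mult_ac del: power_Suc)
  finally have "(\<Sum>i\<le>Suc k. t (Suc k) s i) = qpoch q a (Suc k) / ?d (Suc k)"
    by (rule iffD1[OF mult_left_cancel[OF d(3)]])
  then show ?case by (simp only: t_def)
qed simp

text \<open>
  The functions of \<open>s\<close> in which all series below are expanded, at the points \<open>s, sq, sq\<^sup>2, \<dots>\<close>.
\<close>
definition qratio :: "complex \<Rightarrow> complex \<Rightarrow> complex \<Rightarrow> complex" where
  "qratio a c s = qpoch_inf q (s * a) * qpoch_inf q (s * c) / qpoch_inf q s"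

lemma qratio_Bseq: "norm s < 1 \<Longrightarrow> Bseq (\<lambda>n. qratio a c (s * q ^ n))"
  using Bseq_mult[OF qpoch_inf_ratio_Bseq[of s "s * a"] qpoch_inf_Bseq[of "s * c"]]
  by (simp add: qratio_def mult_ac)

lemma norm_q_power_le: "norm (q ^ n) \<le> 1"
  unfolding norm_power by (intro power_le_one) (use norm_q in auto)

lemma shifted_binomial_sum:
  assumes s: "norm s < 1"
  shows "(\<lambda>m. qpoch q a (m + k) / qpoch q q m * s ^ m) sums (qpoch q a k * (qpoch_inf q (s * a * q ^ k) / qpoch_inf q s))"
proof -
  have "(\<lambda>m. qpoch q a k * (qhom 1 (a * q ^ k) m / qpoch q q m * s ^ m)) sums
      (qpoch q a k * (qpoch_inf q (a * q ^ k * s) / qpoch_inf q (1 * s)))"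
    by (intro sums_mult qhom_binomial) (use s in simp)
  then show ?thesis
    by (simp add: qhom_one qpoch_add[of a k] add.commute[of _ k] mult_ac)
qed

text \<open>
  Both sides are power series in \<open>c\<close>. On the left the coefficient is a \<open>q\<close>-binomial series; on the
  right it comes from Euler's expansion of \<open>(s c q\<^sup>i; q)\<^sub>\<infinity>\<close> and is a finite sum, to which
  \<open>qpoch_expansion\<close> applies.
\<close>
lemma two_phi_one_zero:
  assumes s: "norm s < 1"
  shows "(\<lambda>i. qhom 0 1 i * qhom 0 (s * a * c) i / qpoch q q i * qratio a c (s * q ^ i)) sums
    (\<Sum>n. qpoch q a n * qpoch q c n / qpoch q q n * s ^ n)"
proof -
  let ?d = "\<lambda>n. qpoch q q n"
  obtain Ma where Ma: "0 < Ma" "\<And>n. norm (qpoch q a n) \<le> Ma"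
    using qpoch_Bseq[of a] by (auto simp: Bseq_def)
  obtain Mq where Mq: "0 < Mq" "\<And>n. norm (1 / ?d n) \<le> Mq"
    using inverse_qpoch_Bseq[OF qnonzero_q] by (auto simp: Bseq_def)
  obtain Mr where Mr: "0 < Mr" "\<And>n. norm (qpoch_inf q (s * a * q ^ n) / qpoch_inf q (s * q ^ n)) \<le> Mr"
    using qpoch_inf_ratio_Bseq[OF s, of "s * a"] by (auto simp: Bseq_def)
  define f where "f m k = qpoch q a (m + k) * s ^ (m + k) * (1 / ?d m * (qhom 0 c k / ?d k))" for m k
  have f_bound: "norm (f m k) \<le> (Ma * Mq) * (norm s ^ m * norm (qhom 0 c k / ?d k * s ^ k))" for m k
  proof -
    have "norm (f m k) = (norm (qpoch q a (m + k)) * norm (1 / ?d m)) * (norm s ^ m * norm (qhom 0 c k / ?d k * s ^ k))"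
      by (simp add: f_def power_add norm_mult norm_divide norm_power)
    also have "\<dots> \<le> (Ma * Mq) * (norm s ^ m * norm (qhom 0 c k / ?d k * s ^ k))"
      by (intro mult_right_mono mult_mono Ma Mq) (use Ma(1) in auto)
    finally show ?thesis .
  qed
  have geo: "summable (\<lambda>n. norm s ^ n)"
    by (rule summable_geometric) (use s in simp)
  note f_series = dominated_double_series[OF geo summable_qhom[of 0 s c] _ _ f_bound, simplified]
  have "(\<Sum>n. qpoch q a n * qpoch q c n / ?d n * s ^ n) = (\<Sum>j. \<Sum>m\<le>j. f m (j - m))"
  proof (rule suminf_cong)
    fix j
    have "qpoch q c j / ?d j = (\<Sum>m\<le>j. 1 / ?d m * (qhom 0 c (j - m) / ?d (j - m)))"
      using qhom_convolution[of 1 c j] by (simp add: qhom_one)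
    then have "qpoch q a j * s ^ j * (qpoch q c j / ?d j) = (\<Sum>m\<le>j. f m (j - m))"
      by (simp only: sum_distrib_left) (simp add: f_def)
    then show "qpoch q a j * qpoch q c j / ?d j * s ^ j = (\<Sum>m\<le>j. f m (j - m))"
      by (simp add: mult_ac)
  qed
  also have "\<dots> = (\<Sum>k. \<Sum>m. f m k)"
    using f_series by simp
  finally have lhs: "(\<Sum>n. qpoch q a n * qpoch q c n / ?d n * s ^ n) = (\<Sum>k. \<Sum>m. f m k)" .
  define h where "h i l = qhom 0 (c * s) (i + l) * (qhom 0 a i * qpoch q s i * qpoch q (s * a * q ^ i) l
      / (?d i * ?d l)) * (qpoch_inf q (s * a * q ^ (i + l)) / qpoch_inf q s)" for i l
  have h_eq: "h i l = qhom 0 (c * s) i * qhom 0 a i / ?d i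
      * (qpoch_inf q (s * a * q ^ i) / qpoch_inf q (s * q ^ i)) * (qhom 0 (c * s * q ^ i) l / ?d l)" for i l
  proof -
    have "qpoch_inf q (s * a * q ^ i) / qpoch_inf q (s * q ^ i)
        = qpoch_inf q (s * a * q ^ i) * (1 / qpoch_inf q (s * q ^ i))" by simp
    also have "\<dots> = qpoch q (s * a * q ^ i) l * qpoch_inf q (s * a * q ^ (i + l)) * (qpoch q s i / qpoch_inf q s)"
      unfolding inverse_qpoch_inf_shift[OF s] qpoch_inf_split[of "s * a * q ^ i" l]
      by (simp add: power_add mult.assoc)
    finally show ?thesis
      by (simp add: h_def qhom_zero_add[of "c * s"] mult_ac)
  qed
  have column: "(\<Sum>m. f m k) = (\<Sum>i\<le>k. h i (k - i))" for k
  proof -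
    have "(\<lambda>m. qhom 0 (c * s) k / ?d k * (qpoch q a (m + k) / ?d m * s ^ m)) sums
        (qhom 0 (c * s) k / ?d k * (qpoch q a k * (qpoch_inf q (s * a * q ^ k) / qpoch_inf q s)))"
      by (intro sums_mult shifted_binomial_sum s)
    then have "(\<Sum>m. f m k) = qhom 0 (c * s) k * (qpoch q a k / ?d k)
        * (qpoch_inf q (s * a * q ^ k) / qpoch_inf q s)"
      by (simp add: sums_iff f_def qhom_zero[of "c * s"] qhom_zero[of c] power_add power_mult_distrib mult_ac)
    also have "\<dots> = (\<Sum>i\<le>k. h i (k - i))"
      unfolding qpoch_expansion[of a k s] sum_distrib_left sum_distrib_right
      by (rule sum.cong) (simp_all add: h_def)
    finally show ?thesis .
  qed
  have h_bound: "norm (h i l) \<le> Mr * (norm (qhom 0 (c * s) i / ?d i * a ^ i) * norm (qhom 0 (c * s) l / ?d l * 1 ^ l))"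
    for i l
  proof -
    have "qhom 0 (c * s * q ^ i) l = (q ^ i) ^ l * qhom 0 (c * s) l"
      by (simp add: qhom_zero[of "c * s * q ^ i"] qhom_zero[of "c * s"] power_mult_distrib)
    then have "norm (h i l) = (norm (qpoch_inf q (s * a * q ^ i) / qpoch_inf q (s * q ^ i)) * norm (qhom 0 1 i) * norm ((q ^ i) ^ l))
        * (norm (qhom 0 (c * s) i / ?d i * a ^ i) * norm (qhom 0 (c * s) l / ?d l * 1 ^ l))"
      by (simp add: h_eq qhom_zero[of a] norm_mult norm_divide mult_ac)
    also have "\<dots> \<le> (Mr * 1 * 1) * (norm (qhom 0 (c * s) i / ?d i * a ^ i) * norm (qhom 0 (c * s) l / ?d l * 1 ^ l))"
      by (intro mult_right_mono mult_mono Mr norm_qhom_zero_le) (use Mr(1) norm_q_power_le in \<open>auto simp: power_mult[symmetric]\<close>)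
    finally show ?thesis by simp
  qed
  note h_series = dominated_double_series[OF summable_qhom[of 0 a "c * s"] summable_qhom[of 0 1 "c * s"] _ _ h_bound, simplified]
  have row: "(\<Sum>l. h i l) = qhom 0 1 i * qhom 0 (s * a * c) i / ?d i * qratio a c (s * q ^ i)" for i
  proof -
    have "(\<lambda>l. qhom 0 (c * s) i * qhom 0 a i / ?d i
      * (qpoch_inf q (s * a * q ^ i) / qpoch_inf q (s * q ^ i)) * (qhom 0 (c * s * q ^ i) l / ?d l * 1 ^ l)) sums
      (qhom 0 (c * s) i * qhom 0 a i / ?d i
      * (qpoch_inf q (s * a * q ^ i) / qpoch_inf q (s * q ^ i)) * qpoch_inf q (c * s * q ^ i * 1))"
      by (intro sums_mult Euler_expansion)
    moreover have "qhom 0 (c * s) i * qhom 0 a i = qhom 0 1 i * qhom 0 (s * a * c) i"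
      unfolding qhom_zero[of "c * s"] qhom_zero[of "s * a * c"] qhom_zero[of a]
      by (simp add: power_mult_distrib)
    ultimately have "(\<lambda>l. h i l) sums (qhom 0 1 i * qhom 0 (s * a * c) i / ?d i
        * (qpoch_inf q (s * a * q ^ i) / qpoch_inf q (s * q ^ i)) * qpoch_inf q (c * s * q ^ i))"
      by (simp only: h_eq mult_1_right power_one)
    then show ?thesis
      by (simp add: sums_iff qratio_def mult_ac)
  qed
  have "(\<Sum>k. \<Sum>m. f m k) = (\<Sum>i. \<Sum>l. h i l)"
    unfolding column using h_series by simp
  moreover have "summable (\<lambda>i. \<Sum>l. h i l)"
    using h_series by simp
  ultimately show ?thesis
    unfolding lhs row by (simp add: sums_iff)
qed

lemma qhom_zero_one_add: "qhom 0 1 (k + i) = qhom 0 1 k * qhom 0 (q ^ k) i"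
  using qhom_zero_add[of 1 k i] by simp

lemma qhom_zero_mult: "qhom 0 (x * y) i = x ^ i * qhom 0 y i"
  using qhom_scale[of x 0 y i] by simp

text \<open>
  Expanding \<open>(y q\<^sup>n; q)\<^sub>\<infinity>\<close> in powers of \<open>y\<close> turns the sum into a combination of the series of
  \<open>two_phi_one_zero\<close> at the arguments \<open>s q\<^sup>k\<close>.
\<close>
lemma two_phi_one_with_numerator:
  assumes s: "norm s < 1"
  shows "(\<lambda>m. qhom 0 1 m * qhom y (s * a * c) m / qpoch q q m * qratio a c (s * q ^ m)) sums
    (\<Sum>n. qpoch q a n * qpoch q c n / qpoch q q n * s ^ n * qpoch_inf q (y * q ^ n))"
proof -
  let ?d = "\<lambda>n. qpoch q q n"
  let ?A = "\<lambda>n. qpoch q a n * qpoch q c n * (1 / ?d n)"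
  have A_Bseq: "Bseq ?A"
    by (intro Bseq_mult qpoch_Bseq inverse_qpoch_Bseq qnonzero_q)
  then obtain MA where MA: "0 < MA" "\<And>n. norm (?A n) \<le> MA"
    by (auto simp: Bseq_def)
  obtain MG where MG: "0 < MG" "\<And>n. norm (qratio a c (s * q ^ n)) \<le> MG"
    using qratio_Bseq[OF s, of a c] by (auto simp: Bseq_def)
  define f where "f n k = ?A n * s ^ n * (qhom 0 y k / ?d k * (q ^ n) ^ k)" for n k
  have f_bound: "norm (f n k) \<le> MA * (norm s ^ n * norm (qhom 0 y k / ?d k * 1 ^ k))" for n k
  proof -
    have "norm (f n k) = (norm (?A n) * norm ((q ^ n) ^ k)) * (norm s ^ n * norm (qhom 0 y k / ?d k * 1 ^ k))"
      by (simp add: f_def norm_mult norm_divide norm_power)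
    also have "\<dots> \<le> (MA * 1) * (norm s ^ n * norm (qhom 0 y k / ?d k * 1 ^ k))"
      by (intro mult_right_mono mult_mono MA)
         (use MA(1) norm_q_power_le in \<open>auto simp: power_mult[symmetric]\<close>)
    finally show ?thesis by simp
  qed
  have geo: "summable (\<lambda>n. norm s ^ n)"
    by (rule summable_geometric) (use s in simp)
  note f_series = dominated_double_series[OF geo summable_qhom[of 0 1 y] _ _ f_bound, simplified]
  have row: "(\<Sum>k. f n k) = qpoch q a n * qpoch q c n / ?d n * s ^ n * qpoch_inf q (y * q ^ n)" for n
    using sums_mult[OF Euler_expansion[of y "q ^ n"], of "?A n * s ^ n"]
    by (simp add: f_def sums_iff mult_ac)
  define g where "g k i = qhom 0 y k / ?d k
      * (qhom 0 1 i * qhom 0 (s * q ^ k * a * c) i / ?d i * qratio a c (s * q ^ k * q ^ i))" for k i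
  have column: "(\<Sum>n. f n k) = (\<Sum>i. g k i)" for k
  proof -
    have sk: "norm (s * q ^ k) < 1" by (rule norm_shift_less[OF s])
    have "(\<Sum>n. f n k) = (\<Sum>n. qhom 0 y k / ?d k * (?A n * (s * q ^ k) ^ n))"
      by (rule suminf_cong)
         (simp add: f_def power_mult_distrib power_mult[symmetric] mult.commute[of k] mult_ac)
    also have "\<dots> = qhom 0 y k / ?d k * (\<Sum>n. ?A n * (s * q ^ k) ^ n)"
      by (rule suminf_mult[OF summable_Bseq_geometric[OF A_Bseq sk]])
    also have "\<dots> = (\<Sum>i. g k i)"
      using sums_mult[OF two_phi_one_zero[OF sk, of a c], of "qhom 0 y k / ?d k"]
      by (simp add: g_def sums_iff)
    finally show ?thesis .
  qed
  have g_eq: "g k i = (qhom 0 1 (k + i) * qratio a c (s * q ^ (k + i)))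
      * (y ^ k / ?d k * (qhom 0 (s * a * c) i / ?d i))" for k i
    using qhom_zero_mult[of "q ^ k" 1 i] qhom_zero_mult[of "q ^ k" "s * a * c" i]
    by (simp add: g_def qhom_zero[of y] qhom_zero_one_add power_add mult_ac)
  have g_bound: "norm (g k i) \<le> MG * (norm (qhom 0 y k / ?d k * 1 ^ k) * norm (qhom 0 (s * a * c) i / ?d i * 1 ^ i))"
    for k i
  proof -
    have "norm (g k i) = (norm (qratio a c (s * q ^ (k + i))) * norm (qhom 0 (q ^ k) i))
        * (norm (qhom 0 y k / ?d k * 1 ^ k) * norm (qhom 0 (s * a * c) i / ?d i * 1 ^ i))"
      by (simp add: g_eq qhom_zero[of y] qhom_zero_one_add norm_mult norm_divide mult_ac)
    also have "\<dots> \<le> (MG * 1) * (norm (qhom 0 y k / ?d k * 1 ^ k) * norm (qhom 0 (s * a * c) i / ?d i * 1 ^ i))"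
      by (intro mult_right_mono mult_mono MG norm_qhom_zero_le norm_q_power_le) (use MG(1) in auto)
    finally show ?thesis by simp
  qed
  note g_series = dominated_double_series[OF summable_qhom[of 0 1 y] summable_qhom[of 0 1 "s * a * c"] _ _ g_bound, simplified]
  have diagonal: "(\<Sum>k\<le>m. g k (m - k)) = qhom 0 1 m * qhom y (s * a * c) m / ?d m * qratio a c (s * q ^ m)" for m
  proof -
    have "(\<Sum>k\<le>m. g k (m - k)) = (\<Sum>k\<le>m. (qhom 0 1 m * qratio a c (s * q ^ m))
        * (y ^ k / ?d k * (qhom 0 (s * a * c) (m - k) / ?d (m - k))))"
      by (rule sum.cong) (simp_all add: g_eq)
    also have "\<dots> = qhom 0 1 m * qratio a c (s * q ^ m) * (qhom y (s * a * c) m / ?d m)"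
      unfolding sum_distrib_left[symmetric] qhom_convolution[symmetric] ..
    finally show ?thesis by (simp add: mult_ac)
  qed
  have "(\<Sum>n. \<Sum>k. f n k) = (\<Sum>m. \<Sum>k\<le>m. g k (m - k))"
    using f_series g_series unfolding column by simp
  moreover have "summable (\<lambda>m. \<Sum>k\<le>m. g k (m - k))"
    using g_series by simp
  ultimately show ?thesis
    unfolding diagonal row by (simp add: sums_iff)
qed

text \<open>
  Expanding the quotient of \<open>(b u q\<^sup>n; q)\<^sub>\<infinity>\<close> by \<open>(b q\<^sup>n; q)\<^sub>\<infinity>\<close> leaves sums of the preceding kind with
  \<open>s = z q\<^sup>k\<close> and \<open>y = z w\<close>. The condition \<open>u w = a c\<close> is what makes \<open>qhom y (s a c)\<close> factor as
  \<open>(z w)\<^sup>m (u q\<^sup>k; q)\<^sub>m\<close>, so that \<open>(u; q)\<^sub>k\<close> and \<open>(u q\<^sup>k; q)\<^sub>m\<close> combine to a function of the diagonal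
  index \<open>k + m\<close>.
\<close>
lemma three_phi_two_entire:
  assumes z: "norm z < 1" and b: "norm b < 1" and uw: "u * w = a * c"
  shows "(\<lambda>j. qpoch q u j * qhom b (z * w) j / qpoch q q j * qratio a c (z * q ^ j)) sums
    (\<Sum>n. qpoch q a n * qpoch q c n / qpoch q q n * z ^ n
         * (qpoch_inf q (b * u * q ^ n) * qpoch_inf q (z * w * q ^ n) / qpoch_inf q (b * q ^ n)))"
proof -
  let ?d = "\<lambda>n. qpoch q q n"
  let ?A = "\<lambda>n. qpoch q a n * qpoch q c n * (1 / ?d n) * qpoch_inf q (z * w * q ^ n)"
  have A_Bseq: "Bseq ?A"
    by (intro Bseq_mult qpoch_Bseq inverse_qpoch_Bseq qnonzero_q qpoch_inf_Bseq)
  then obtain MA where MA: "0 < MA" "\<And>n. norm (?A n) \<le> MA"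
    by (auto simp: Bseq_def)
  obtain MG where MG: "0 < MG" "\<And>n. norm (qratio a c (z * q ^ n)) \<le> MG"
    using qratio_Bseq[OF z, of a c] by (auto simp: Bseq_def)
  obtain Mu where Mu: "0 < Mu" "\<And>n. norm (qpoch q u n) \<le> Mu"
    using qpoch_Bseq[of u] by (auto simp: Bseq_def)
  have geo: "summable (\<lambda>n. norm z ^ n)"
    by (rule summable_geometric) (use z in simp)
  have b_binomial: "summable (\<lambda>k. norm (qhom 1 u k / ?d k * b ^ k))" "summable (\<lambda>k. norm (qhom 1 0 k / ?d k * b ^ k))"
    by (rule summable_qhom, use b in simp)+
  define f where "f n k = ?A n * z ^ n * (qhom 1 u k / ?d k * (b * q ^ n) ^ k)" for n k
  have f_bound: "norm (f n k) \<le> MA * (norm z ^ n * norm (qhom 1 u k / ?d k * b ^ k))" for n k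
  proof -
    have "norm (f n k) = (norm (?A n) * norm ((q ^ n) ^ k)) * (norm z ^ n * norm (qhom 1 u k / ?d k * b ^ k))"
      by (simp add: f_def norm_mult norm_divide norm_power power_mult_distrib)
    also have "\<dots> \<le> (MA * 1) * (norm z ^ n * norm (qhom 1 u k / ?d k * b ^ k))"
      by (intro mult_right_mono mult_mono MA)
         (use MA(1) norm_q_power_le in \<open>auto simp: power_mult[symmetric]\<close>)
    finally show ?thesis by simp
  qed
  note f_series = dominated_double_series[OF geo b_binomial(1) _ _ f_bound, simplified]
  have row: "(\<Sum>k. f n k) = qpoch q a n * qpoch q c n / ?d n * z ^ n
      * (qpoch_inf q (b * u * q ^ n) * qpoch_inf q (z * w * q ^ n) / qpoch_inf q (b * q ^ n))" for n
  proof -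
    have "(\<lambda>k. qhom 1 u k / ?d k * (b * q ^ n) ^ k) sums
        (qpoch_inf q (u * (b * q ^ n)) / qpoch_inf q (1 * (b * q ^ n)))"
      by (rule qhom_binomial) (use norm_shift_less[OF b] in simp)
    from sums_mult[OF this, of "?A n * z ^ n"] show ?thesis
      by (simp add: f_def sums_iff mult_ac)
  qed
  define g where "g k m = qhom 1 u k / ?d k * b ^ k
      * (qhom 0 1 m * qhom (z * w) (z * q ^ k * a * c) m / ?d m * qratio a c (z * q ^ k * q ^ m))" for k m
  have column: "(\<Sum>n. f n k) = (\<Sum>m. g k m)" for k
  proof -
    have zk: "norm (z * q ^ k) < 1" by (rule norm_shift_less[OF z])
    have "(\<Sum>n. f n k) = (\<Sum>n. qhom 1 u k / ?d k * b ^ k * (?A n * (z * q ^ k) ^ n))"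
      by (rule suminf_cong)
         (simp add: f_def power_mult_distrib power_mult[symmetric] mult.commute[of k] mult_ac)
    also have "\<dots> = qhom 1 u k / ?d k * b ^ k * (\<Sum>n. ?A n * (z * q ^ k) ^ n)"
      by (rule suminf_mult[OF summable_Bseq_geometric[OF A_Bseq zk]])
    also have "(\<Sum>n. ?A n * (z * q ^ k) ^ n)
        = (\<Sum>n. qpoch q a n * qpoch q c n / ?d n * (z * q ^ k) ^ n * qpoch_inf q (z * w * q ^ n))"
      by (rule suminf_cong) (simp add: mult_ac)
    also have "qhom 1 u k / ?d k * b ^ k * \<dots> = (\<Sum>m. g k m)"
      using sums_mult[OF two_phi_one_with_numerator[OF zk, of "z * w" a c], of "qhom 1 u k / ?d k * b ^ k"]
      by (simp add: g_def sums_iff)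
    finally show ?thesis .
  qed
  have g_eq: "g k m = (qpoch q u (k + m) * qratio a c (z * q ^ (k + m)))
      * (b ^ k / ?d k * (qhom 0 (z * w) m / ?d m))" for k m
  proof -
    have arg: "z * q ^ k * a * c = (z * w) * (u * q ^ k)"
      using arg_cong[OF uw, of "\<lambda>p. z * q ^ k * p"] by (simp only: mult_ac)
    have scaled: "qhom (z * w) (z * q ^ k * a * c) m = (z * w) ^ m * qpoch q (u * q ^ k) m"
      unfolding arg using qhom_scale[of "z * w" 1 "u * q ^ k" m] by (simp add: qhom_one)
    show ?thesis
      unfolding g_def scaled qhom_zero[of "z * w"] qhom_one qpoch_add power_add
      by (simp add: mult_ac)
  qed
  have g_bound: "norm (g k m) \<le> (Mu * MG) * (norm (qhom 1 0 k / ?d k * b ^ k) * norm (qhom 0 (z * w) m / ?d m * 1 ^ m))"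
    for k m
  proof -
    \<comment> \<open>so the majorant in \<open>k\<close> is a geometric sequence divided by \<open>(q; q)\<^sub>k\<close>\<close>
    have "qhom 1 0 k = 1" by (simp add: qhom_def)
    then have "norm (g k m) = (norm (qpoch q u (k + m)) * norm (qratio a c (z * q ^ (k + m))))
        * (norm (qhom 1 0 k / ?d k * b ^ k) * norm (qhom 0 (z * w) m / ?d m * 1 ^ m))"
      by (simp add: g_eq norm_mult norm_divide mult_ac)
    also have "\<dots> \<le> (Mu * MG) * (norm (qhom 1 0 k / ?d k * b ^ k) * norm (qhom 0 (z * w) m / ?d m * 1 ^ m))"
      by (intro mult_right_mono mult_mono MG Mu) (use Mu(1) in auto)
    finally show ?thesis .
  qed
  note g_series = dominated_double_series[OF b_binomial(2) summable_qhom[of 0 1 "z * w"] _ _ g_bound, simplified]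
  have diagonal: "(\<Sum>k\<le>j. g k (j - k)) = qpoch q u j * qhom b (z * w) j / ?d j * qratio a c (z * q ^ j)" for j
  proof -
    have "(\<Sum>k\<le>j. g k (j - k)) = (\<Sum>k\<le>j. (qpoch q u j * qratio a c (z * q ^ j))
        * (b ^ k / ?d k * (qhom 0 (z * w) (j - k) / ?d (j - k))))"
      by (rule sum.cong) (simp_all add: g_eq)
    also have "\<dots> = qpoch q u j * qratio a c (z * q ^ j) * (qhom b (z * w) j / ?d j)"
      unfolding sum_distrib_left[symmetric] qhom_convolution[symmetric] ..
    finally show ?thesis by (simp add: mult_ac)
  qed
  have "(\<Sum>n. \<Sum>k. f n k) = (\<Sum>j. \<Sum>k\<le>j. g k (j - k))"
    using f_series g_series unfolding column by simp
  moreover have "summable (\<lambda>j. \<Sum>k\<le>j. g k (j - k))"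
    using g_series by simp
  ultimately show ?thesis
    unfolding diagonal row by (simp add: sums_iff)
qed

lemma phi32_sums:
  assumes z: "norm z < 1" and d: "qnonzero q d" and e: "qnonzero q e"
  shows "(\<lambda>n. qpoch q a n * qpoch q b n * qpoch q c n / (qpoch q q n * qpoch q d n * qpoch q e n) * z ^ n)
    sums phi32 a b c d e q z"
proof -
  have "Bseq (\<lambda>n. qpoch q a n * qpoch q b n * qpoch q c n
      * (1 / qpoch q q n * (1 / qpoch q d n) * (1 / qpoch q e n)))"
    by (intro Bseq_mult qpoch_Bseq inverse_qpoch_Bseq qnonzero_q d e)
  from summable_sums[OF summable_Bseq_geometric[OF this z]] show ?thesis
    by (simp add: phi32_def qpochs_def mult_ac)
qed

text \<open>
  The denominator parameters are written \<open>d = b u\<close>, \<open>e = b v\<close>, which turns \<open>z = d e/(a b c)\<close>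
  into the division-free condition below. In the entire form, each infinite product is split as
  \<open>(t q\<^sup>n; q)\<^sub>\<infinity> = (t; q)\<^sub>\<infinity> / (t; q)\<^sub>n\<close>, which is where the genericity assumptions enter.
\<close>
lemma phi32_transformation:
  assumes z: "norm z < 1" "z \<noteq> 0" and b: "norm b < 1" and parameters: "z * a * c = b * u * v"
    and nonzero: "qnonzero q (b * u)" "qnonzero q (b * v)" "qnonzero q (z * c)" "qnonzero q (z * a)"
  shows "phi32 b a c (b * u) (b * v) q z =
    qpoch_inf q b * qpoch_inf q (z * c) * qpoch_inf q (z * a)
      / (qpoch_inf q (b * u) * qpoch_inf q (b * v) * qpoch_inf q z)
    * phi32 z u v (z * c) (z * a) q b"
proof -
  let ?P = "\<lambda>x. qpoch_inf q x"
  \<comment> \<open>chosen so that \<open>z w\<close> is the denominator parameter \<open>b v\<close>\<close>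
  define w where "w = b * v / z"
  have zw: "z * w = b * v" and uw: "u * w = a * c"
    using z(2) parameters by (auto simp: w_def field_simps)
  have infinite: "?P (b * u) \<noteq> 0" "?P (b * v) \<noteq> 0" "?P (z * c) \<noteq> 0" "?P (z * a) \<noteq> 0" "?P b \<noteq> 0" "?P z \<noteq> 0"
    using nonzero qnonzero_small[OF b] qnonzero_small[OF z(1)] by (simp_all add: qpoch_inf_nonzero)
  have tail: "?P (x * q ^ n) = ?P x / qpoch q x n" if "qnonzero q x" for x n
    using qpoch_inf_split[of x n] qpoch_nonzero[OF that, of n] by (simp add: field_simps)
  note tails = tail[OF nonzero(1)] tail[OF nonzero(2)] tail[OF nonzero(3)] tail[OF nonzero(4)]
    tail[OF qnonzero_small[OF b]] tail[OF qnonzero_small[OF z(1)]]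
  define K where "K = ?P (b * u) * ?P (b * v) / ?P b"
  define K' where "K' = ?P (z * a) * ?P (z * c) / ?P z"
  have "qpoch q a n * qpoch q c n / qpoch q q n * z ^ n
         * (?P (b * u * q ^ n) * ?P (z * w * q ^ n) / ?P (b * q ^ n))
      = K * (qpoch q b n * qpoch q a n * qpoch q c n
            / (qpoch q q n * qpoch q (b * u) n * qpoch q (b * v) n) * z ^ n)" for n
    unfolding zw tails by (simp add: K_def mult_ac)
  then have left: "(\<Sum>n. qpoch q a n * qpoch q c n / qpoch q q n * z ^ n
         * (?P (b * u * q ^ n) * ?P (z * w * q ^ n) / ?P (b * q ^ n))) = K * phi32 b a c (b * u) (b * v) q z"
    using sums_mult[OF phi32_sums[OF z(1) nonzero(1,2), of b a c], of K] by (simp add: sums_iff)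
  have right: "qpoch q u j * qhom b (z * w) j / qpoch q q j * qratio a c (z * q ^ j)
      = K' * (qpoch q z j * qpoch q u j * qpoch q v j
            / (qpoch q q j * qpoch q (z * c) j * qpoch q (z * a) j) * b ^ j)" for j
  proof -
    have "qhom b (z * w) j = b ^ j * qpoch q v j"
      using qhom_scale[of b 1 v j] by (simp add: zw qhom_one)
    moreover have "qratio a c (z * q ^ j) = ?P (z * a * q ^ j) * ?P (z * c * q ^ j) / ?P (z * q ^ j)"
      by (simp add: qratio_def mult_ac)
    ultimately show ?thesis
      unfolding tails by (simp add: K'_def mult_ac)
  qed
  have "K * phi32 b a c (b * u) (b * v) q z = K' * phi32 z u v (z * c) (z * a) q b"
    using three_phi_two_entire[OF z(1) b uw] sums_mult[OF phi32_sums[OF b nonzero(3,4), of z u v], of K']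
    unfolding left right by (rule sums_unique2)
  then show ?thesis
    using infinite by (simp add: K_def K'_def field_simps)
qed

definition theta :: "complex \<Rightarrow> complex" where
  "theta x = qpoch_inf q x * qpoch_inf q (q / x)"

lemma theta_shift:
  assumes "q \<noteq> 0" "x \<noteq> 0"
  shows "theta (q * x) = - theta x / x"
proof -
  have first: "qpoch_inf q x = (1 - x) * qpoch_inf q (q * x)"
    using qpoch_inf_shift[of x] by (simp add: mult.commute)
  have second: "qpoch_inf q (q / (q * x)) = (1 - 1 / x) * qpoch_inf q (q / x)"
    using qpoch_inf_shift[of "1 / x"] assms by simp
  show ?thesis
    unfolding theta_def first second using assms by (simp add: field_simps)
qed

end

section \<open>The three identities\<close>

lemma pow_log_nonzero: "pow_log l s \<noteq> 0"
  by (simp add: pow_log_def)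

lemma pow_log_add: "pow_log l (s + t) = pow_log l s * pow_log l t"
  by (simp add: pow_log_def distrib_right exp_add)

lemma pow_log_diff: "pow_log l (s - t) = pow_log l s / pow_log l t"
  by (simp add: pow_log_def left_diff_distrib exp_diff)

lemma pow_log_minus: "pow_log l (- s) = 1 / pow_log l s"
  using pow_log_diff[of l 0 s] by (simp add: pow_log_def)

lemma pow_log_sum: "pow_log (l + m) s = pow_log l s * pow_log m s"
  by (simp add: pow_log_def distrib_left exp_add)

lemma pow_log_1: "pow_log l 1 = exp l"
  by (simp add: pow_log_def)

lemma pow_log_2: "pow_log l 2 = (exp l)\<^sup>2"
  by (simp add: pow_log_def exp_double power2_eq_square)

text \<open>
  The transformation with \<open>b = q\<^bsup>-lam\<^esup> b2 x\<close> and \<open>u = q\<^bsup>lam\<^esup>\<close>; the products \<open>z a\<close>, \<open>z c\<close> and \<open>b v\<close> do not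
  involve \<open>x\<close>, hence neither does the factor \<open>K\<close> between the two functions.
\<close>
lemma f32_constant_multiple_of_y_beta:
  fixes q a1 a2 b1 b2 lam mu lq lb2 :: complex and L :: "complex \<Rightarrow> complex"
  assumes q: "0 < norm q" "norm q < 1"
    and nz: "a1 \<noteq> 0" "a2 \<noteq> 0" "b1 \<noteq> 0" "b2 \<noteq> 0"
    and lq: "exp lq = q"
    and lam: "norm (pow_log lq lam * (a1 * a2 / (b1 * b2))) < 1"
    and generic_y: "qnonzero q (b2 / a1)" "qnonzero q (q * b2 / a2)" "qnonzero q (q * b2 / b1)"
    and generic_f: "qnonzero q (pow_log lq (lam + 1) * a1 / b1)" "qnonzero q (pow_log lq lam * a2 / b1)"
  shows "\<exists>c. \<forall>x. x \<noteq> 0 \<and> norm (pow_log lq (- lam) * b2 * x) < 1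
          \<and> qnonzero q (b2 * x) \<and> qnonzero q (pow_log lq (- lam) * b2 * x)
        \<longrightarrow> f32 q lq a1 a2 b1 b2 lam L x = c * y_beta q lq a1 a2 b2 b1 lb2 lam mu L x"
proof -
  interpret q_base q by standard (rule q)
  define Q where "Q = pow_log lq lam"
  define z where "z = Q * (a1 * a2 / (b1 * b2))"
  define a where "a = b2 / a1"
  define c where "c = q * b2 / a2"
  define K where "K = (1 - q) * pow_log lb2 (lam - mu) * qpoch_inf q q * qpoch_inf q (z * c) * qpoch_inf q (z * a)
      / (qpoch_inf q a * qpoch_inf q c * qpoch_inf q z)"
  have q0: "q \<noteq> 0" "q \<noteq> 1" using q by auto
  have Q0: "Q \<noteq> 0" by (simp add: Q_def pow_log_nonzero)
  have z: "norm z < 1" "z \<noteq> 0" using lam nz Q0 by (simp_all add: z_def Q_def)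
  have zc: "z * c = pow_log lq (lam + 1) * a1 / b1" and za: "z * a = pow_log lq lam * a2 / b1"
    using nz lq by (simp_all add: z_def c_def a_def Q_def pow_log_add pow_log_1)
  have generic: "qnonzero q (z * c)" "qnonzero q (z * a)" "qnonzero q a" "qnonzero q c"
    using generic_f generic_y unfolding zc za by (simp_all add: a_def c_def)
  have "K \<noteq> 0"
    unfolding K_def using q0 generic qnonzero_q qnonzero_small[OF z(1)]
    by (simp add: qpoch_inf_nonzero pow_log_nonzero)
  show ?thesis
  proof (intro exI[of _ "1 / K"] allI impI, elim conjE)
    fix x
    assume x: "x \<noteq> 0" "norm (pow_log lq (- lam) * b2 * x) < 1" "qnonzero q (b2 * x)"
    define b where "b = pow_log lq (- lam) * b2 * x"
    have b_eq: "b = b2 * x / Q" by (simp add: b_def pow_log_minus Q_def)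
    have b: "norm b < 1" using x by (simp add: b_def)
    define v where "v = pow_log lq (lam + 1) / (b1 * x)"
    have bQ: "b * Q = b2 * x" and bv: "b * v = q * b2 / b1"
      using x nz Q0 lq by (simp_all add: b_eq v_def pow_log_add pow_log_1 Q_def[symmetric])
    have parameters: "z * a * c = b * Q * v"
      using x nz Q0 lq by (simp add: b_eq v_def z_def a_def c_def pow_log_add pow_log_1 Q_def[symmetric])
    have "phi32 b a c (b * Q) (b * v) q z =
        qpoch_inf q b * qpoch_inf q (z * c) * qpoch_inf q (z * a)
          / (qpoch_inf q (b * Q) * qpoch_inf q (b * v) * qpoch_inf q z) * phi32 z Q v (z * c) (z * a) q b"
      by (rule phi32_transformation[OF z b parameters]) (use x generic_y generic in \<open>simp_all add: bQ bv\<close>)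
    moreover have "qpoch_inf q b \<noteq> 0" "qpoch_inf q (b * Q) \<noteq> 0" "qpoch_inf q (b * v) \<noteq> 0"
      using x generic_y b by (simp_all add: bQ bv qpoch_inf_nonzero qnonzero_small)
    moreover have "y_beta q lq a1 a2 b2 b1 lb2 lam mu L x = (1 - q) * pow_log lb2 (lam - mu) * pow_log (L x) lam
        * (qpoch_inf q (b * Q) * qpoch_inf q q * qpoch_inf q (b * v) / (qpoch_inf q b * qpoch_inf q a * qpoch_inf q c))
        * phi32 b a c (b * Q) (b * v) q z"
      unfolding bQ bv by (simp add: y_beta_def qpochs_inf_def a_def c_def b_def z_def Q_def mult_ac)
    ultimately have y: "y_beta q lq a1 a2 b2 b1 lb2 lam mu L x = K * (pow_log (L x) lam * phi32 z Q v (z * c) (z * a) q b)"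
      by (simp add: K_def mult_ac)
    have f: "f32 q lq a1 a2 b1 b2 lam L x = pow_log (L x) lam * phi32 z Q v (z * c) (z * a) q b"
      unfolding f32_def zc za by (simp only: v_def b_def z_def Q_def)
    show "f32 q lq a1 a2 b1 b2 lam L x = 1 / K * y_beta q lq a1 a2 b2 b1 lb2 lam mu L x"
      using \<open>K \<noteq> 0\<close> by (simp add: y f)
  qed
qed

text \<open>
  The transformation with \<open>b = q/(a1 x)\<close>. The quotient of the two functions is \<open>x\<^bsup>lam-mu\<^esup>\<close> times
  \<open>\<theta>(a2 x/q) / \<theta>(r x)\<close> and a constant. Replacing \<open>x\<close> by \<open>qx\<close> multiplies the theta quotient by
  \<open>(r x) / (a2 x/q)\<close> and the power by \<open>q\<^bsup>lam-mu\<^esup>\<close>, which is the inverse of that factor by the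
  condition on \<open>mu\<close>.
\<close>
lemma f35_pseudo_constant_multiple_of_y_x:
  fixes q a1 a2 b1 b2 lam mu lq :: complex and L :: "complex \<Rightarrow> complex"
  assumes q: "0 < norm q" "norm q < 1"
    and nz: "a1 \<noteq> 0" "a2 \<noteq> 0" "b1 \<noteq> 0" "b2 \<noteq> 0"
    and logs: "exp lq = q" "\<And>x. x \<noteq> 0 \<Longrightarrow> L (q * x) = lq + L x"
    and mu: "pow_log lq mu * (a1 * a2 / (b1 * b2)) = 1"
    and lam: "norm (pow_log lq lam * (a1 * a2 / (b1 * b2))) < 1"
    and generic_y: "qnonzero q (pow_log lq (- lam + 1))"
    and generic_f: "qnonzero q (q * a1 * a2 / (b1 * b2))"
  shows "\<exists>S. (\<forall>x. S (q * x) = S x)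
        \<and> (\<forall>x. x \<noteq> 0 \<and> norm (q / (a1 * x)) < 1
          \<and> qnonzero q (q\<^sup>2 / (b1 * x)) \<and> qnonzero q (q\<^sup>2 / (b2 * x))
          \<and> qnonzero q (q / (a1 * x)) \<and> qnonzero q (q\<^sup>2 / (a2 * x))
          \<and> qnonzero q (pow_log lq (- lam - 1) * b1 * b2 * x / a1)
          \<and> qnonzero q (pow_log lq (lam + 2) * a1 / (b1 * b2 * x))
        \<longrightarrow> f35 q lq a1 a2 b1 b2 lam L x = S x * y_x q lq a1 a2 b1 b2 lam mu L x)"
proof -
  interpret q_base q by standard (rule q)
  define Q where "Q = pow_log lq lam"
  define z where "z = Q * (a1 * a2 / (b1 * b2))"
  define a where "a = q / Q"
  define r where "r = b1 * b2 / (Q * q * a1)"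
  define K where "K = (1 - q) * pow_log lq (lam - mu) * qpoch_inf q q * qpoch_inf q (z * a)
      / (qpoch_inf q a * qpoch_inf q z)"
  define S where "S x = (if x = 0 then 0
      else pow_log (L x) (lam - mu) * theta (a2 / q * x) / theta (r * x) / K)" for x
  have q0: "q \<noteq> 0" "q \<noteq> 1" using q by auto
  have Q0: "Q \<noteq> 0" by (simp add: Q_def pow_log_nonzero)
  have z: "norm z < 1" "z \<noteq> 0" using lam nz Q0 by (simp_all add: z_def Q_def)
  have za: "z * a = q * a1 * a2 / (b1 * b2)"
    using Q0 by (simp add: z_def a_def)
  have a: "pow_log lq (- lam + 1) = a"
    using logs by (simp only: pow_log_add pow_log_minus pow_log_1 a_def Q_def) simp
  have generic: "qnonzero q (z * a)" "qnonzero q a"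
    using generic_f generic_y by (simp_all only: za a)
  have "K \<noteq> 0"
    unfolding K_def using q0 generic qnonzero_q qnonzero_small[OF z(1)]
    by (simp add: qpoch_inf_nonzero pow_log_nonzero)
  have r0: "r \<noteq> 0" using nz Q0 q0 by (simp add: r_def)
  have periodic: "S (q * x) = S x" for x
  proof (cases "x = 0")
    case False
    have "pow_log lq mu = b1 * b2 / (a1 * a2)"
      using mu nz by (simp add: field_simps)
    then have "pow_log lq (lam - mu) = z"
      by (simp add: pow_log_diff z_def Q_def)
    also have "z = (a2 / q * x) / (r * x)"
      using False nz Q0 q0 by (simp add: z_def r_def)
    finally have step: "pow_log lq (lam - mu) = (a2 / q * x) / (r * x)" .
    have "theta (a2 / q * (q * x)) = - theta (a2 / q * x) / (a2 / q * x)"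
      "theta (r * (q * x)) = - theta (r * x) / (r * x)"
      using theta_shift[of "a2 / q * x"] theta_shift[of "r * x"] False nz q0 r0
      by (simp_all add: mult.left_commute)
    then show ?thesis
      using False nz q0 r0 by (simp add: S_def logs(2) pow_log_sum step)
  qed (simp add: S_def)
  show ?thesis
  proof (intro exI[of _ S] conjI allI periodic impI, elim conjE)
    fix x
    assume x: "x \<noteq> 0" "norm (q / (a1 * x)) < 1"
      and gen: "qnonzero q (q\<^sup>2 / (b1 * x))" "qnonzero q (q\<^sup>2 / (b2 * x))" "qnonzero q (q\<^sup>2 / (a2 * x))"
        "qnonzero q (pow_log lq (- lam - 1) * b1 * b2 * x / a1)"
        "qnonzero q (pow_log lq (lam + 2) * a1 / (b1 * b2 * x))"
    define b where "b = q / (a1 * x)"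
    define c where "c = q\<^sup>2 / (a2 * x)"
    define u where "u = q * a1 / b1"
    define v where "v = q * a1 / b2"
    have bu: "b * u = q\<^sup>2 / (b1 * x)" and bv: "b * v = q\<^sup>2 / (b2 * x)"
      using x nz by (simp_all add: b_def u_def v_def power2_eq_square)
    have zc: "z * c = pow_log lq (lam + 2) * a1 / (b1 * b2 * x)"
      using nz logs by (simp add: z_def c_def Q_def pow_log_add pow_log_2 mult_ac)
    have parameters: "z * a * c = b * u * v"
      using x nz Q0 by (simp add: z_def a_def b_def c_def u_def v_def power2_eq_square mult_ac)
    have rx: "pow_log lq (- lam - 1) * b1 * b2 * x / a1 = r * x"
      using nz logs by (simp add: pow_log_diff pow_log_minus pow_log_1 r_def Q_def mult_ac)
    have q_rx: "q / (r * x) = z * c" and q_a2: "q / (a2 / q * x) = c"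
      using x nz q0 Q0 by (simp_all add: r_def z_def c_def power2_eq_square field_simps)
    have b: "norm b < 1" using x by (simp add: b_def)
    have inf: "qpoch_inf q (b * u) \<noteq> 0" "qpoch_inf q (b * v) \<noteq> 0" "qpoch_inf q c \<noteq> 0"
      "qpoch_inf q (r * x) \<noteq> 0" "qpoch_inf q (z * c) \<noteq> 0" "qpoch_inf q b \<noteq> 0"
      using gen b unfolding bu bv c_def[symmetric] rx zc[symmetric]
      by (simp_all add: qpoch_inf_nonzero qnonzero_small)
    have "phi32 b a c (b * u) (b * v) q z =
        qpoch_inf q b * qpoch_inf q (z * c) * qpoch_inf q (z * a)
          / (qpoch_inf q (b * u) * qpoch_inf q (b * v) * qpoch_inf q z) * phi32 z u v (z * c) (z * a) q b"
      by (rule phi32_transformation[OF z b parameters])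
         (use gen generic in \<open>simp_all add: bu bv zc[symmetric]\<close>)
    moreover have "phi32 a b c (b * u) (b * v) q z = phi32 b a c (b * u) (b * v) q z"
      by (simp add: phi32_def qpochs_def mult_ac)
    moreover have "y_x q lq a1 a2 b1 b2 lam mu L x = (1 - q) * pow_log lq (lam - mu) * pow_log (L x) mu
        * (qpoch_inf q (b * u) * qpoch_inf q (b * v) * qpoch_inf q q / (qpoch_inf q b * qpoch_inf q c * qpoch_inf q a))
        * phi32 a b c (b * u) (b * v) q z"
      unfolding bu bv y_x_def a by (simp add: qpochs_inf_def c_def b_def z_def Q_def mult_ac)
    ultimately have y: "y_x q lq a1 a2 b1 b2 lam mu L x
        = K * qpoch_inf q (z * c) / qpoch_inf q c * (pow_log (L x) mu * phi32 z u v (z * c) (z * a) q b)"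
      using inf by (simp add: K_def mult_ac)
    have f: "f35 q lq a1 a2 b1 b2 lam L x = pow_log (L x) lam * (qpoch_inf q (a2 / q * x) / qpoch_inf q (r * x))
        * phi32 z u v (z * c) (z * a) q b"
      unfolding f35_def rx zc[symmetric] za[symmetric]
      by (simp add: u_def v_def z_def Q_def b_def)
    have "S x = pow_log (L x) lam / pow_log (L x) mu * (qpoch_inf q (a2 / q * x) * qpoch_inf q c)
        / (qpoch_inf q (r * x) * qpoch_inf q (z * c)) / K"
      unfolding S_def theta_def q_rx q_a2 pow_log_diff using x by simp
    then show "f35 q lq a1 a2 b1 b2 lam L x = S x * y_x q lq a1 a2 b1 b2 lam mu L x"
      unfolding f y using inf \<open>K \<noteq> 0\<close> pow_log_nonzero[of "L x" mu] by simp
  qed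
qed

theorem proposition3p3:
  fixes q a1 a2 b1 b2 lam mu lq lb1 lb2 :: complex
    and L :: "complex \<Rightarrow> complex"
  assumes q: "0 < norm q" "norm q < 1"
    and nz: "a1 \<noteq> 0" "a2 \<noteq> 0" "b1 \<noteq> 0" "b2 \<noteq> 0"
    and logs: "exp lq = q" "exp lb1 = b1" "exp lb2 = b2"
      "\<And>x. x \<noteq> 0 \<Longrightarrow> exp (L x) = x"
      "\<And>x. x \<noteq> 0 \<Longrightarrow> L (q * x) = lq + L x"
    and mu: "pow_log lq mu * (a1 * a2 / (b1 * b2)) = 1"
    and lam: "norm (pow_log lq lam * (a1 * a2 / (b1 * b2))) < 1"
    and generic_y_beta1: "qnonzero q (b1 / a1)" "qnonzero q (q * b1 / a2)" "qnonzero q (q * b1 / b2)"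
    and generic_y_beta2: "qnonzero q (b2 / a1)" "qnonzero q (q * b2 / a2)" "qnonzero q (q * b2 / b1)"
    and generic_y_x: "qnonzero q (pow_log lq (- lam + 1))"
    and generic_f32: "qnonzero q (pow_log lq (lam + 1) * a1 / b1)" "qnonzero q (pow_log lq lam * a2 / b1)"
    and generic_f32_check: "qnonzero q (pow_log lq (lam + 1) * a1 / b2)" "qnonzero q (pow_log lq lam * a2 / b2)"
    and generic_f35: "qnonzero q (q * a1 * a2 / (b1 * b2))"
  shows
    "(\<exists>c. \<forall>x. x \<noteq> 0 \<and> norm (pow_log lq (- lam) * b2 * x) < 1
          \<and> qnonzero q (b2 * x) \<and> qnonzero q (pow_log lq (- lam) * b2 * x)
        \<longrightarrow> f32 q lq a1 a2 b1 b2 lam L x = c * y_beta q lq a1 a2 b2 b1 lb2 lam mu L x)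
     \<and> (\<exists>c. \<forall>x. x \<noteq> 0 \<and> norm (pow_log lq (- lam) * b1 * x) < 1
          \<and> qnonzero q (b1 * x) \<and> qnonzero q (pow_log lq (- lam) * b1 * x)
        \<longrightarrow> f32_check q lq a1 a2 b1 b2 lam L x = c * y_beta q lq a1 a2 b1 b2 lb1 lam mu L x)
     \<and> (\<exists>S. (\<forall>x. S (q * x) = S x)
        \<and> (\<forall>x. x \<noteq> 0 \<and> norm (q / (a1 * x)) < 1
          \<and> qnonzero q (q\<^sup>2 / (b1 * x)) \<and> qnonzero q (q\<^sup>2 / (b2 * x))
          \<and> qnonzero q (q / (a1 * x)) \<and> qnonzero q (q\<^sup>2 / (a2 * x))
          \<and> qnonzero q (pow_log lq (- lam - 1) * b1 * b2 * x / a1)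
          \<and> qnonzero q (pow_log lq (lam + 2) * a1 / (b1 * b2 * x))
        \<longrightarrow> f35 q lq a1 a2 b1 b2 lam L x = S x * y_x q lq a1 a2 b1 b2 lam mu L x))"
proof (intro conjI)
  show "\<exists>c. \<forall>x. x \<noteq> 0 \<and> norm (pow_log lq (- lam) * b2 * x) < 1
          \<and> qnonzero q (b2 * x) \<and> qnonzero q (pow_log lq (- lam) * b2 * x)
        \<longrightarrow> f32 q lq a1 a2 b1 b2 lam L x = c * y_beta q lq a1 a2 b2 b1 lb2 lam mu L x"
    by (rule f32_constant_multiple_of_y_beta[OF q nz logs(1) lam generic_y_beta2 generic_f32])
  have "norm (pow_log lq lam * (a1 * a2 / (b2 * b1))) < 1"
    using lam by (simp add: mult.commute[of b2])
  then show "\<exists>c. \<forall>x. x \<noteq> 0 \<and> norm (pow_log lq (- lam) * b1 * x) < 1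
          \<and> qnonzero q (b1 * x) \<and> qnonzero q (pow_log lq (- lam) * b1 * x)
        \<longrightarrow> f32_check q lq a1 a2 b1 b2 lam L x = c * y_beta q lq a1 a2 b1 b2 lb1 lam mu L x"
    unfolding f32_check_def
    by (rule f32_constant_multiple_of_y_beta[OF q nz(1,2,4,3) logs(1) _ generic_y_beta1 generic_f32_check])
qed (rule f35_pseudo_constant_multiple_of_y_x[where L = L, OF q nz logs(1,5) mu lam generic_y_x generic_f35])

end
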